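(* Let $\omega(n)$ be any function with $\omega(n)=o(\log n)$, let $p=p(n)=\sqrt{\frac{2\log n+\omega(n)}{n}}$, and let $G\sim\mathcal{G}(n,p)$. Then with high probability $\mathrm{rc}(G)=\mathrm{diam}(G)\in\{2,3\}$.
   Context: $\mathcal{G}(n,p)$ is the Erdős–Rényi random graph on $n$ vertices in which each of the $\binom n2$ potential edges is present independently with probability $p$. An event holds with high probability (whp) if its probability tends to $1$ as $n\to\infty$. Given an edge colouring of a graph, a rainbow path is a path all of whose edges have distinct colours; a colouring is a rainbow colouring if every pair of vertices is joined by at least one rainbow path. The rainbow connection number $\mathrm{rc}(G)$ is the minimum number of colours in a rainbow colouring of the edges of $G$. *)

theory Defs
  imports "HOL-Probability.Probability" "HOL-Library.Landau_Symbols" "HOL-Library.Ramsey"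
    "HOL-Library.Extended_Nat"
begin

text \<open>
  A simple graph is given by its vertex set \<open>V\<close> and its edge set \<open>E\<close>,
  a set of two-element subsets of \<open>V\<close>.
\<close>

fun path_edges :: "'a list \<Rightarrow> 'a set list" where
  "path_edges (x # y # xs) = {x, y} # path_edges (y # xs)"
| "path_edges _ = []"

definition is_path :: "'a set \<Rightarrow> 'a set set \<Rightarrow> 'a \<Rightarrow> 'a \<Rightarrow> 'a list \<Rightarrow> bool" where
  "is_path V E u v xs \<longleftrightarrow>
     xs \<noteq> [] \<and> hd xs = u \<and> last xs = v \<and> set xs \<subseteq> V \<and> distinct xs \<and> set (path_edges xs) \<subseteq> E"

text \<open>Since \<open>Inf {} = \<infinity>\<close>, vertices in different components are at distance \<open>\<infinity>\<close>.\<close>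

definition graph_dist :: "'a set \<Rightarrow> 'a set set \<Rightarrow> 'a \<Rightarrow> 'a \<Rightarrow> enat" where
  "graph_dist V E u v = Inf {enat (length (path_edges xs)) | xs. is_path V E u v xs}"

definition graph_diam :: "'a set \<Rightarrow> 'a set set \<Rightarrow> enat" where
  "graph_diam V E = Sup {graph_dist V E u v | u v. u \<in> V \<and> v \<in> V}"

definition rainbow_path ::
    "'a set \<Rightarrow> 'a set set \<Rightarrow> ('a set \<Rightarrow> 'c) \<Rightarrow> 'a \<Rightarrow> 'a \<Rightarrow> 'a list \<Rightarrow> bool" where
  "rainbow_path V E c u v xs \<longleftrightarrow> is_path V E u v xs \<and> distinct (map c (path_edges xs))"

definition rainbow_colouring :: "'a set \<Rightarrow> 'a set set \<Rightarrow> ('a set \<Rightarrow> 'c) \<Rightarrow> bool" where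
  "rainbow_colouring V E c \<longleftrightarrow> (\<forall>u\<in>V. \<forall>v\<in>V. \<exists>xs. rainbow_path V E c u v xs)"

text \<open>
  The infimum is a minimum if some rainbow colouring with finitely many colours exists;
  otherwise (in particular for disconnected graphs) it is \<open>\<infinity>\<close>.
\<close>

definition rainbow_connection :: "'a set \<Rightarrow> 'a set set \<Rightarrow> enat" where
  "rainbow_connection V E =
     Inf {enat k | k. \<exists>c :: 'a set \<Rightarrow> nat. c ` E \<subseteq> {..<k} \<and> rainbow_colouring V E c}"

text \<open>
  The distribution of the edge set of the random graph on the vertex set \<open>{..<n}\<close>.
  Note that \<^const>\<open>bernoulli_pmf\<close> truncates its parameter to the interval \<open>[0, 1]\<close>.
\<close>

definition random_graph :: "nat \<Rightarrow> real \<Rightarrow> nat set set pmf" where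
  "random_graph n p =
     map_pmf (\<lambda>present. {e \<in> nsets {..<n} 2. present e})
       (Pi_pmf (nsets {..<n} 2) False (\<lambda>_. bernoulli_pmf p))"

end

theory Submission
  imports Defs "HOL-Real_Asymp.Real_Asymp"
begin

text \<open>
  With high probability \<open>G\<close> is not complete, and every two distinct vertices are joined by a path of
  three edges that is rainbow for the fixed colouring \<open>{x, y} \<mapsto> (x + y) mod 3\<close>. As always
  \<open>diam G \<le> rc G\<close>, this settles the case that some nonadjacent pair has no common neighbour.

  Otherwise two colours are found with the asymmetric local lemma for a uniformly random colouring, the
  bad events being that all paths of two edges between a nonadjacent pair are monochromatic. Since
  \<open>n p\<^sup>2\<close> is close to \<open>2 ln n\<close>, pairs with boundedly many common neighbours are so rare that they do not
  interact, while the events of all other pairs using a given edge have a small total weight.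
\<close>

text \<open>At \<open>n p^2\<close> near \<open>2 ln n\<close> a given pair has no common neighbour
  with probability \<open>n^(-2 + o(1))\<close>, so both diameters can occur and pairs with few
  common neighbours sit at the threshold of existence. This defeats the simple arguments for two
  colours. A typical pair has about \<open>2 ln n\<close> common neighbours, hence a bad event of
  probability about \<open>n^(-1.39)\<close>, too much for a union bound over \<open>n^2\<close>
  pairs; and a pair with a single common neighbour has a bad event of probability 1/2, too much for
  the symmetric local lemma. With weight \<open>\<theta>^k\<close>, however, a pair has expected
  weight about \<open>exp (- (1 - \<theta>) n p^2)\<close>, near \<open>n^(-0.9)\<close>, while one
  edge is read by only \<open>n^(1/2 + o(1))\<close> of the events. The rare pairs are controlled
  separately: two given ones are both small with probability below \<open>n^(-3.7)\<close> for large
  \<open>n\<close>, and there are in expectation only \<open>n^(3 + o(1))\<close> places where two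
  pairs could touch the same vertex.\<close>

section \<open>Independence in finite products\<close>

text \<open>Values of any type are allowed, so that events, real random variables and exposed random
  sets such as a neighbourhood fall under one notion. \<open>D\<close> may reach outside the index
  set of the product.\<close>

definition depends_on :: "'a set \<Rightarrow> (('a \<Rightarrow> 'b) \<Rightarrow> 'c) \<Rightarrow> bool" where
  "depends_on D f \<longleftrightarrow> (\<forall>g h. (\<forall>e\<in>D. g e = h e) \<longrightarrow> f g = f h)"

lemma depends_onI: "(\<And>g h. (\<And>e. e \<in> D \<Longrightarrow> g e = h e) \<Longrightarrow> f g = f h) \<Longrightarrow> depends_on D f"
  unfolding depends_on_def by blast

lemma depends_onD: "depends_on D f \<Longrightarrow> (\<And>e. e \<in> D \<Longrightarrow> g e = h e) \<Longrightarrow> f g = f h"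
  unfolding depends_on_def by blast

lemma depends_on_comp: "depends_on D f \<Longrightarrow> depends_on D (\<lambda>g. k (f g))"
  by (rule depends_onI) (rule arg_cong[where f = k], erule depends_onD)

lemma depends_on_prod:
  fixes f :: "'w \<Rightarrow> ('a \<Rightarrow> 'b) \<Rightarrow> 'c :: comm_monoid_mult"
  assumes "\<And>w. w \<in> W \<Longrightarrow> depends_on (D w) (f w)"
  shows "depends_on (\<Union>w\<in>W. D w) (\<lambda>g. \<Prod>w\<in>W. f w g)"
proof (rule depends_onI)
  fix g h :: "'a \<Rightarrow> 'b" assume "\<And>e. e \<in> (\<Union>w\<in>W. D w) \<Longrightarrow> g e = h e"
  then show "(\<Prod>w\<in>W. f w g) = (\<Prod>w\<in>W. f w h)"
    by (intro prod.cong refl depends_onD[OF assms]) auto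
qed

lemma expectation_pair_mult:
  fixes f h :: "_ \<Rightarrow> real"
  assumes "finite (set_pmf p)" "finite (set_pmf q)"
  shows "measure_pmf.expectation (pair_pmf p q) (\<lambda>x. f (fst x) * h (snd x)) =
    measure_pmf.expectation p f * measure_pmf.expectation q h"
proof -
  have "measure_pmf.expectation (pair_pmf p q) (\<lambda>x. f (fst x) * h (snd x)) =
    (\<Sum>x\<in>set_pmf p \<times> set_pmf q. f (fst x) * h (snd x) * pmf (pair_pmf p q) x)"
    using assms by (subst integral_measure_pmf_real[where A = "set_pmf p \<times> set_pmf q"]) auto
  also have "\<dots> = (\<Sum>(a, b)\<in>set_pmf p \<times> set_pmf q. (f a * pmf p a) * (h b * pmf q b))"
    by (intro sum.cong refl) (auto simp: pmf_pair)
  also have "\<dots> = (\<Sum>a\<in>set_pmf p. f a * pmf p a) * (\<Sum>b\<in>set_pmf q. h b * pmf q b)"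
    by (simp add: sum_product sum.cartesian_product)
  also have "\<dots> = measure_pmf.expectation p f * measure_pmf.expectation q h"
    using assms by (simp add: integral_measure_pmf_real[where A = "set_pmf p"]
        integral_measure_pmf_real[where A = "set_pmf q"])
  finally show ?thesis .
qed

context
  fixes X :: "'a set" and q :: "'a \<Rightarrow> bool pmf"
  assumes finX: "finite X"
begin

abbreviation (input) "\<P> \<equiv> Pi_pmf X False q"
abbreviation (input) "\<E> \<equiv> measure_pmf.expectation (Pi_pmf X False q)"
abbreviation (input) "\<PP> P \<equiv> measure_pmf.prob (Pi_pmf X False q) {g. P g}"

lemma finite_set_Pi_bool: "finite (set_pmf (Pi_pmf X False q))"
  using finX by (subst set_Pi_pmf) auto

lemma integrable_Pi_bool: "integrable (Pi_pmf X False q) (f :: _ \<Rightarrow> real)"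
  by (rule integrable_measure_pmf_finite[OF finite_set_Pi_bool])

lemma expectation_of_bool: "\<E> (\<lambda>g. of_bool (P g)) = \<PP> P"
proof -
  have "(\<lambda>g. of_bool (P g) :: real) = indicator {g. P g}" by (auto simp: indicator_def)
  then show ?thesis by (simp add: measure_pmf.emeasure_eq_measure)
qed

lemma expectation_mono:
  assumes "\<And>g. (f g :: real) \<le> h g" shows "\<E> f \<le> \<E> h"
  by (rule integral_mono[OF integrable_Pi_bool integrable_Pi_bool assms])

text \<open>Split the index set into \<open>X \<inter> D\<close> and \<open>X - D\<close>: the
  random function is glued from two independent parts, and \<open>f\<close> sees only the first,
  \<open>h\<close> only the second.\<close>

lemma expectation_mult_indep:
  fixes f h :: "_ \<Rightarrow> real"
  assumes f: "depends_on D f" and h: "depends_on D' h" and "D \<inter> D' = {}"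
  shows "\<E> (\<lambda>g. f g * h g) = \<E> f * \<E> h"
proof -
  define Y where "Y = X \<inter> D"
  define Z where "Z = X - D"
  have XYZ: "X = Y \<union> Z" "finite Y" "finite Z" "Y \<inter> Z = {}" using finX by (auto simp: Y_def Z_def)
  define J where "J = pair_pmf (Pi_pmf Y False q) (Pi_pmf Z False q)"
  define c :: "('a \<Rightarrow> bool) \<Rightarrow> ('a \<Rightarrow> bool) \<Rightarrow> 'a \<Rightarrow> bool"
    where "c a b x = (if x \<in> Y then a x else b x)" for a b x
  have P: "\<P> = map_pmf (\<lambda>(a, b). c a b) J"
    unfolding XYZ(1) J_def c_def by (rule Pi_pmf_union) (use XYZ in auto)
  \<comment> \<open>A point of \<open>D\<close> outside \<open>X\<close> belongs to neither part;
    there all sampled functions take the default value \<open>False\<close>, so \<open>f\<close>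
    cannot tell \<open>c a b\<close> from \<open>a\<close>.\<close>
  have out: "a e = False" if "(a, b) \<in> set_pmf J" "e \<notin> Y" for a b e
    using that set_Pi_pmf_subset[OF XYZ(2), of False q] by (auto simp: J_def)
  have out': "b e = False" if "(a, b) \<in> set_pmf J" "e \<notin> Z" for a b e
    using that set_Pi_pmf_subset[OF XYZ(3), of False q] by (auto simp: J_def)
  have fa: "f (c a b) = f a" if "(a, b) \<in> set_pmf J" for a b
    using out[OF that] out'[OF that] by (intro depends_onD[OF f]) (auto simp: Y_def Z_def c_def)
  have hb: "h (c a b) = h b" if "(a, b) \<in> set_pmf J" for a b
    using assms(3) out[OF that] out'[OF that] by (intro depends_onD[OF h]) (auto simp: Y_def Z_def c_def)
  have E: "\<E> k = measure_pmf.expectation J (\<lambda>(a,b). k (c a b))" for k :: "_ \<Rightarrow> real"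
    unfolding P by (simp add: case_prod_unfold)
  have fs: "finite (set_pmf (Pi_pmf Y False q))" "finite (set_pmf (Pi_pmf Z False q))"
    using XYZ by (auto simp: set_Pi_pmf)
  have 1: "\<E> (\<lambda>g. f g * h g) = measure_pmf.expectation J (\<lambda>x. f (fst x) * h (snd x))"
    unfolding E by (intro integral_cong_AE) (auto simp: AE_measure_pmf_iff fa hb)
  have 2: "\<E> f = measure_pmf.expectation J (\<lambda>x. f (fst x))"
    unfolding E by (intro integral_cong_AE) (auto simp: AE_measure_pmf_iff fa)
  have 3: "\<E> h = measure_pmf.expectation J (\<lambda>x. h (snd x))"
    unfolding E by (intro integral_cong_AE) (auto simp: AE_measure_pmf_iff hb)
  show ?thesis unfolding 1 2 3 unfolding J_def expectation_pair_mult[OF fs] by simp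
qed

lemma prob_indep:
  assumes f: "depends_on D P" and h: "depends_on D' Q" and "D \<inter> D' = {}"
  shows "\<PP> (\<lambda>g. P g \<and> Q g) = \<PP> P * \<PP> Q"
proof -
  have "depends_on D (\<lambda>g. of_bool (P g) :: real)" "depends_on D' (\<lambda>g. of_bool (Q g) :: real)"
    using f h by (auto intro: depends_on_comp[where k = of_bool])
  then have "\<E> (\<lambda>g. of_bool (P g) * of_bool (Q g)) = (\<E> (\<lambda>g. of_bool (P g)) * \<E> (\<lambda>g. of_bool (Q g)) :: real)"
    by (rule expectation_mult_indep[OF _ _ assms(3)])
  then show ?thesis by (simp add: expectation_of_bool flip: of_bool_conj)
qed

lemma expectation_prod_indep:
  fixes f :: "'w \<Rightarrow> _ \<Rightarrow> real"
  assumes "finite W" and dep: "\<And>w. w \<in> W \<Longrightarrow> depends_on (D w) (f w)"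
    and disj: "\<And>v w. v \<in> W \<Longrightarrow> w \<in> W \<Longrightarrow> v \<noteq> w \<Longrightarrow> D v \<inter> D w = {}"
  shows "\<E> (\<lambda>g. \<Prod>w\<in>W. f w g) = (\<Prod>w\<in>W. \<E> (f w))"
  using assms
proof (induction W rule: finite_induct)
  case empty
  then show ?case by simp
next
  case (insert v W)
  have "\<E> (\<lambda>g. f v g * (\<Prod>w\<in>W. f w g)) = \<E> (f v) * \<E> (\<lambda>g. \<Prod>w\<in>W. f w g)"
    by (rule expectation_mult_indep[of "D v" _ "\<Union>w\<in>W. D w"])
      (use insert in \<open>auto intro!: depends_on_prod simp del: UN_iff\<close>)
  then show ?case using insert by simp
qed

lemma prob_all_indep:
  assumes "finite W" and dep: "\<And>w. w \<in> W \<Longrightarrow> depends_on (D w) (P w)"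
    and disj: "\<And>v w. v \<in> W \<Longrightarrow> w \<in> W \<Longrightarrow> v \<noteq> w \<Longrightarrow> D v \<inter> D w = {}"
  shows "\<PP> (\<lambda>g. \<forall>w\<in>W. P w g) = (\<Prod>w\<in>W. \<PP> (P w))"
proof -
  have "depends_on (D w) (\<lambda>g. of_bool (P w g) :: real)" if "w \<in> W" for w
    using dep[OF that] by (rule depends_on_comp)
  then have "\<E> (\<lambda>g. \<Prod>w\<in>W. of_bool (P w g)) = (\<Prod>w\<in>W. \<E> (\<lambda>g. of_bool (P w g)) :: real)"
    by (rule expectation_prod_indep[OF assms(1) _ disj])
  moreover have "(\<Prod>w\<in>W. of_bool (P w g)) = (of_bool (\<forall>w\<in>W. P w g) :: real)" for g
    using \<open>finite W\<close> by (induction W rule: finite_induct) auto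
  ultimately show ?thesis by (simp add: expectation_of_bool)
qed

lemma prob_component: "e \<in> X \<Longrightarrow> \<PP> (\<lambda>g. g e) = pmf (q e) True"
proof -
  assume e: "e \<in> X"
  have "\<PP> (\<lambda>g. g e) = measure_pmf.prob (map_pmf (\<lambda>g. g e) \<P>) {True}"
    by (simp add: vimage_def)
  then show ?thesis using e finX by (simp add: Pi_pmf_component measure_pmf_single)
qed

lemma prob_all_present:
  assumes "F \<subseteq> X" and "\<And>e. e \<in> F \<Longrightarrow> pmf (q e) True = p"
  shows "\<PP> (\<lambda>g. \<forall>e\<in>F. g e) = p ^ card F"
proof -
  have "finite F" using assms finX by (auto intro: finite_subset)
  then have "\<PP> (\<lambda>g. \<forall>e\<in>F. g e) = (\<Prod>e\<in>F. \<PP> (\<lambda>g. g e))"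
    by (intro prob_all_indep[where D = "\<lambda>e. {e}"]) (auto simp: depends_on_def)
  also have "\<dots> = (\<Prod>e\<in>F. p)"
    using assms by (intro prod.cong) (auto simp: prob_component)
  finally show ?thesis by simp
qed

text \<open>Exposure argument: once the coordinates in \<open>S\<close> have revealed the value
  \<open>d\<close> of \<open>\<Phi>\<close>, the event \<open>H d\<close> is decided by fresh
  coordinates. Summing over the finitely many values \<open>d\<close> takes the place of conditional
  probabilities.\<close>

lemma prob_cond_le:
  fixes \<Phi> :: "('a \<Rightarrow> bool) \<Rightarrow> 'd"
  assumes \<Phi>: "depends_on S \<Phi>" and H: "\<And>d. good d \<Longrightarrow> depends_on (T d) (H d)"
    and disj: "\<And>d. good d \<Longrightarrow> S \<inter> T d = {}" and b: "\<And>d. good d \<Longrightarrow> \<PP> (H d) \<le> b" "0 \<le> b"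
  shows "\<PP> (\<lambda>g. good (\<Phi> g) \<and> H (\<Phi> g) g) \<le> b"
proof -
  define R where "R = {d \<in> \<Phi> ` set_pmf \<P>. good d}"
  have fR: "finite R" by (simp add: R_def finite_set_Pi_bool)
  have *: "of_bool (good (\<Phi> g) \<and> H (\<Phi> g) g) = (\<Sum>d\<in>R. of_bool (\<Phi> g = d \<and> H d g) :: real)"
    if "g \<in> set_pmf \<P>" for g
  proof (cases "good (\<Phi> g)")
    case True
    then have "\<Phi> g \<in> R" using that by (auto simp: R_def)
    have "(\<Sum>d\<in>R. of_bool (\<Phi> g = d \<and> H d g) :: real) = (\<Sum>d\<in>{\<Phi> g}. of_bool (\<Phi> g = d \<and> H d g))"
      using fR \<open>\<Phi> g \<in> R\<close> by (intro sum.mono_neutral_right) auto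
    then show ?thesis using True by simp
  next
    case False
    then have "\<Phi> g \<notin> R" by (auto simp: R_def)
    then have "(\<Sum>d\<in>R. of_bool (\<Phi> g = d \<and> H d g) :: real) = 0" by (intro sum.neutral) auto
    then show ?thesis using False by simp
  qed
  have "\<PP> (\<lambda>g. good (\<Phi> g) \<and> H (\<Phi> g) g) = \<E> (\<lambda>g. of_bool (good (\<Phi> g) \<and> H (\<Phi> g) g))"
    by (simp only: expectation_of_bool)
  also have "\<dots> = \<E> (\<lambda>g. \<Sum>d\<in>R. of_bool (\<Phi> g = d \<and> H d g))"
    by (intro integral_cong_AE) (auto simp: AE_measure_pmf_iff *)
  also have "\<dots> = (\<Sum>d\<in>R. \<E> (\<lambda>g. of_bool (\<Phi> g = d \<and> H d g)))"
    by (intro Bochner_Integration.integral_sum integrable_Pi_bool)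
  also have "\<dots> = (\<Sum>d\<in>R. \<PP> (\<lambda>g. \<Phi> g = d) * \<PP> (H d))"
  proof (intro sum.cong refl)
    fix d assume "d \<in> R"
    have "depends_on S (\<lambda>g. \<Phi> g = d)" using \<Phi> by (auto simp: depends_on_def)
    then show "\<E> (\<lambda>g. of_bool (\<Phi> g = d \<and> H d g)) = \<PP> (\<lambda>g. \<Phi> g = d) * \<PP> (H d)"
      using \<open>d \<in> R\<close> by (simp only: expectation_of_bool) (intro prob_indep[OF _ H disj], auto simp: R_def)
  qed
  also have "\<dots> \<le> (\<Sum>d\<in>R. \<PP> (\<lambda>g. \<Phi> g = d) * b)"
    by (intro sum_mono mult_left_mono b) (auto simp: R_def)
  also have "\<dots> = (\<Sum>d\<in>R. measure_pmf.prob \<P> {g. \<Phi> g = d}) * b"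
    by (simp add: sum_distrib_right)
  also have "(\<Sum>d\<in>R. measure_pmf.prob \<P> {g. \<Phi> g = d}) = measure_pmf.prob \<P> (\<Union>d\<in>R. {g. \<Phi> g = d})"
    using fR by (subst measure_pmf.finite_measure_finite_Union) (auto simp: disjoint_family_on_def)
  also have "\<dots> * b \<le> 1 * b"
    by (intro mult_right_mono b(2)) auto
  finally show ?thesis by simp
qed

end

section \<open>The asymmetric local lemma\<close>

text \<open>Induction on the number of other events avoided: non-neighbours factor out by
  independence, neighbours are paid for by the product of the \<open>1 - x j\<close>. All
  inequalities are multiplied out, so nothing is conditioned on an event of possibly zero
  probability.\<close>

lemma lovasz_local:
  fixes M :: "'a pmf" and A :: "'i \<Rightarrow> 'a set" and x :: "'i \<Rightarrow> real" and nb :: "'i \<Rightarrow> 'i set"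
  assumes "finite I" and x: "\<And>i. i \<in> I \<Longrightarrow> 0 \<le> x i \<and> x i < 1"
    and indep: "\<And>i S. i \<in> I \<Longrightarrow> S \<subseteq> I - nb i - {i} \<Longrightarrow>
      measure_pmf.prob M (A i \<inter> (\<Inter>j\<in>S. - A j)) = measure_pmf.prob M (A i) * measure_pmf.prob M (\<Inter>j\<in>S. - A j)"
    and bound: "\<And>i. i \<in> I \<Longrightarrow> measure_pmf.prob M (A i) \<le> x i * (\<Prod>j\<in>I \<inter> nb i - {i}. 1 - x j)"
  shows "measure_pmf.prob M (\<Inter>j\<in>I. - A j) > 0"
proof -
  define N where "N S = measure_pmf.prob M (\<Inter>j\<in>S. - A j)" for S
  have step: "(1 - x j) * N T \<le> N (insert j T)"
    if "measure_pmf.prob M (A j \<inter> (\<Inter>j\<in>T. - A j)) \<le> x j * N T" for j T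
  proof -
    have "N T = measure_pmf.prob M (A j \<inter> (\<Inter>j\<in>T. - A j)) + N (insert j T)"
      unfolding N_def
      by (subst measure_pmf.finite_measure_Union[symmetric]) (auto intro: arg_cong[where f = "measure_pmf.prob M"])
    then show ?thesis using that by (simp add: algebra_simps)
  qed
  \<comment> \<open>This is \<open>P(A i | no A j with j in S) \<le> x i\<close>, multiplied by the
    probability of the condition.\<close>
  have key: "measure_pmf.prob M (A i \<inter> (\<Inter>j\<in>S. - A j)) \<le> x i * N S"
    if "S \<subseteq> I" "i \<in> I" "i \<notin> S" for S i
    using that
  proof (induction "card S" arbitrary: S i rule: less_induct)
    case less
    have finS: "finite S" using less.prems \<open>finite I\<close> by (auto intro: finite_subset)
    define S1 S2 where "S1 = S \<inter> nb i" and "S2 = S - nb i"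
    \<comment> \<open>The neighbours in \<open>S\<close> are added to \<open>S2\<close> one at a
      time; the set present before each addition is a proper subset of \<open>S\<close>, so the
      induction hypothesis covers every step.\<close>
    have chain: "(\<Prod>j\<in>U. 1 - x j) * N S2 \<le> N (S2 \<union> U)" if "finite U" "U \<subseteq> S1" for U
      using that
    proof (induction U rule: finite_induct)
      case empty
      then show ?case by simp
    next
      case (insert j U)
      have sub: "S2 \<union> U \<subset> S" "j \<in> S" "j \<notin> S2 \<union> U" "j \<in> I"
        using insert.prems insert.hyps less.prems by (auto simp: S1_def S2_def)
      have "(1 - x j) * N (S2 \<union> U) \<le> N (insert j (S2 \<union> U))"
        using sub less.prems finS by (intro step less.hyps) (auto intro: psubset_card_mono)
      moreover have "(1 - x j) * ((\<Prod>j\<in>U. 1 - x j) * N S2) \<le> (1 - x j) * N (S2 \<union> U)"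
        using insert x[OF \<open>j \<in> I\<close>] by (intro mult_left_mono) auto
      ultimately show ?case using insert.hyps by (simp add: mult.assoc)
    qed
    have "measure_pmf.prob M (A i \<inter> (\<Inter>j\<in>S. - A j)) \<le> measure_pmf.prob M (A i \<inter> (\<Inter>j\<in>S2. - A j))"
      by (intro measure_pmf.finite_measure_mono) (auto simp: S2_def)
    also have "\<dots> = measure_pmf.prob M (A i) * N S2"
      unfolding N_def by (intro indep) (use less.prems in \<open>auto simp: S2_def\<close>)
    also have "\<dots> \<le> (x i * (\<Prod>j\<in>I \<inter> nb i - {i}. 1 - x j)) * N S2"
      using less.prems by (intro mult_right_mono bound) (auto simp: N_def)
    \<comment> \<open>Neighbours outside \<open>S\<close> only contribute factors of at most 1,
      which may be dropped.\<close>
    also have "\<dots> \<le> (x i * (\<Prod>j\<in>S1. 1 - x j)) * N S2"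
    proof (intro mult_right_mono mult_left_mono)
      have "(\<Prod>j\<in>I \<inter> nb i - {i}. 1 - x j) = (\<Prod>j\<in>S1. 1 - x j) * (\<Prod>j\<in>(I \<inter> nb i - {i}) - S1. 1 - x j)"
        using \<open>finite I\<close> less.prems by (subst prod.subset_diff[of S1]) (auto simp: S1_def)
      also have "\<dots> \<le> (\<Prod>j\<in>S1. 1 - x j) * 1"
        using x less.prems by (intro mult_left_mono prod_le_1 prod_nonneg) (force simp: S1_def)+
      finally show "(\<Prod>j\<in>I \<inter> nb i - {i}. 1 - x j) \<le> (\<Prod>j\<in>S1. 1 - x j)" by simp
    qed (use x less.prems in \<open>auto simp: N_def\<close>)
    also have "\<dots> = x i * ((\<Prod>j\<in>S1. 1 - x j) * N S2)" by simp
    also have "\<dots> \<le> x i * N (S2 \<union> S1)"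
      using chain[of S1] finS x less.prems by (intro mult_left_mono) (auto simp: S1_def)
    also have "S2 \<union> S1 = S" by (auto simp: S1_def S2_def)
    finally show ?case .
  qed
  have "0 < N U" if "finite U" "U \<subseteq> I" for U
    using that
  proof (induction U rule: finite_induct)
    case empty
    then show ?case by (simp add: N_def)
  next
    case (insert j U)
    then have "0 < (1 - x j) * N U" using x by auto
    also have "\<dots> \<le> N (insert j U)" using insert by (intro step key) auto
    finally show ?case .
  qed
  from this[OF \<open>finite I\<close>] show ?thesis by (simp add: N_def)
qed

text \<open>Overlap of the coordinate sets serves as the dependency graph, because an event is
  independent of everything decided on disjoint coordinates; positive probability then yields an
  outcome \<open>g\<close>.\<close>

lemma lovasz_local_product:
  fixes x :: "'i \<Rightarrow> real" and q :: "'a \<Rightarrow> bool pmf"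
  assumes "finite X" "finite I" and x: "\<And>i. i \<in> I \<Longrightarrow> 0 \<le> x i \<and> x i < 1"
    and dep: "\<And>i. i \<in> I \<Longrightarrow> depends_on (D i) (P i)"
    and bound: "\<And>i. i \<in> I \<Longrightarrow> measure_pmf.prob (Pi_pmf X False q) {g. P i g} \<le>
      x i * (\<Prod>j\<in>{j\<in>I. j \<noteq> i \<and> D j \<inter> D i \<noteq> {}}. 1 - x j)"
  shows "\<exists>g. \<forall>i\<in>I. \<not> P i g"
proof -
  have "measure_pmf.prob (Pi_pmf X False q) (\<Inter>j\<in>I. - {g. P j g}) > 0"
  proof (rule lovasz_local[where nb = "\<lambda>i. {j. D j \<inter> D i \<noteq> {}}", OF \<open>finite I\<close> x])
    fix i S assume iS: "i \<in> I" "S \<subseteq> I - {j. D j \<inter> D i \<noteq> {}} - {i}"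
    have "depends_on (\<Union>j\<in>S. D j) (\<lambda>g. \<forall>j\<in>S. \<not> P j g)"
    proof (rule depends_onI)
      fix g h :: "'a \<Rightarrow> bool" assume "\<And>e. e \<in> (\<Union>j\<in>S. D j) \<Longrightarrow> g e = h e"
      then show "(\<forall>j\<in>S. \<not> P j g) = (\<forall>j\<in>S. \<not> P j h)"
        using iS by (intro ball_cong refl arg_cong[where f = Not] depends_onD[OF dep]) auto
    qed
    moreover have "D i \<inter> (\<Union>j\<in>S. D j) = {}" using iS by blast
    ultimately have "measure_pmf.prob (Pi_pmf X False q) {g. P i g \<and> (\<forall>j\<in>S. \<not> P j g)} =
      measure_pmf.prob (Pi_pmf X False q) {g. P i g} * measure_pmf.prob (Pi_pmf X False q) {g. \<forall>j\<in>S. \<not> P j g}"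
      using iS by (intro prob_indep[OF \<open>finite X\<close> dep]) auto
    moreover have "{g. P i g} \<inter> (\<Inter>j\<in>S. - {g. P j g}) = {g. P i g \<and> (\<forall>j\<in>S. \<not> P j g)}"
      "(\<Inter>j\<in>S. - {g. P j g}) = {g. \<forall>j\<in>S. \<not> P j g}" by auto
    ultimately show "measure_pmf.prob (Pi_pmf X False q) ({g. P i g} \<inter> (\<Inter>j\<in>S. - {g. P j g})) =
      measure_pmf.prob (Pi_pmf X False q) {g. P i g} * measure_pmf.prob (Pi_pmf X False q) (\<Inter>j\<in>S. - {g. P j g})"
      by simp
  next
    fix i assume "i \<in> I"
    have "I \<inter> {j. D j \<inter> D i \<noteq> {}} - {i} = {j\<in>I. j \<noteq> i \<and> D j \<inter> D i \<noteq> {}}" by auto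
    then show "measure_pmf.prob (Pi_pmf X False q) {g. P i g} \<le>
      x i * (\<Prod>j\<in>I \<inter> {j. D j \<inter> D i \<noteq> {}} - {i}. 1 - x j)"
      using bound[OF \<open>i \<in> I\<close>] by simp
  qed
  then have "(\<Inter>j\<in>I. - {g. P j g}) \<noteq> {}" by (metis less_irrefl measure_empty)
  then show ?thesis by auto
qed

section \<open>Distances and rainbow colourings\<close>

text \<open>A rainbow path repeats no colour, so with \<open>k\<close> colours available it has at
  most \<open>k\<close> edges.\<close>

lemma graph_diam_le_rainbow_connection: "graph_diam V E \<le> rainbow_connection V E"
  unfolding rainbow_connection_def
proof (rule Inf_greatest, clarify)
  fix k and c :: "'a set \<Rightarrow> nat"
  assume c: "c ` E \<subseteq> {..<k}" "rainbow_colouring V E c"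
  show "graph_diam V E \<le> enat k"
    unfolding graph_diam_def
  proof (rule Sup_least, clarify)
    fix u v assume "u \<in> V" "v \<in> V"
    then obtain xs where xs: "is_path V E u v xs" "distinct (map c (path_edges xs))"
      using c(2) by (auto simp: rainbow_colouring_def rainbow_path_def)
    have "graph_dist V E u v \<le> enat (length (path_edges xs))"
      unfolding graph_dist_def using xs(1) by (intro Inf_lower) auto
    also have "length (path_edges xs) = card (c ` set (path_edges xs))"
      using distinct_card[OF xs(2)] by simp
    also have "\<dots> \<le> card {..<k}"
      using xs(1) c(1) by (intro card_mono) (auto simp: is_path_def)
    finally show "graph_dist V E u v \<le> enat k" by simp
  qed
qed

lemma rainbow_connection_le:
  fixes c :: "'a set \<Rightarrow> nat"
  assumes "c ` E \<subseteq> {..<k}" "rainbow_colouring V E c"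
  shows "rainbow_connection V E \<le> enat k"
  unfolding rainbow_connection_def using assms by (intro Inf_lower) blast

lemma graph_diam_ge:
  assumes "u \<in> V" "v \<in> V" and "\<And>xs. is_path V E u v xs \<Longrightarrow> k \<le> length (path_edges xs)"
  shows "enat k \<le> graph_diam V E"
proof -
  have "enat k \<le> graph_dist V E u v"
    unfolding graph_dist_def using assms(3) by (intro Inf_greatest) auto
  also have "\<dots> \<le> graph_diam V E"
    unfolding graph_diam_def using assms by (intro Sup_upper) auto
  finally show ?thesis .
qed

lemma path_edges_length: "length (path_edges xs) = length xs - 1"
  by (induction xs rule: path_edges.induct) auto

text \<open>The pair is an unordered set \<open>B\<close>, an element of \<open>nsets V 2\<close>
  like an edge, so that each bad event is indexed exactly once.\<close>

definition common_nbrs :: "'a set \<Rightarrow> 'a set set \<Rightarrow> 'a set \<Rightarrow> 'a set" where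
  "common_nbrs V E B = {w\<in>V. \<forall>b\<in>B. {b, w} \<in> E}"

lemma graph_diam_ge_2:
  assumes "B \<in> nsets V 2" "B \<notin> E"
  shows "2 \<le> graph_diam V E"
proof -
  obtain u v where B: "B = {u, v}" "u \<noteq> v" "u \<in> V" "v \<in> V"
    using assms(1) by (auto elim!: nsets2_E)
  have "enat 2 \<le> graph_diam V E"
  proof (rule graph_diam_ge[OF B(3,4)])
    fix xs assume xs: "is_path V E u v xs"
    show "2 \<le> length (path_edges xs)"
      using xs assms(2) B by (cases xs rule: path_edges.cases; cases "tl (tl xs)")
        (auto simp: is_path_def path_edges_length split: if_splits)
  qed
  then show ?thesis by (simp add: numeral_eq_enat)
qed

lemma graph_diam_ge_3:
  assumes "B \<in> nsets V 2" "B \<notin> E" "common_nbrs V E B = {}"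
  shows "3 \<le> graph_diam V E"
proof -
  obtain u v where B: "B = {u, v}" "u \<noteq> v" "u \<in> V" "v \<in> V"
    using assms(1) by (auto elim!: nsets2_E)
  have "enat 3 \<le> graph_diam V E"
  proof (rule graph_diam_ge[OF B(3,4)])
    fix xs assume xs: "is_path V E u v xs"
    show "3 \<le> length (path_edges xs)"
    proof (rule ccontr)
      assume "\<not> 3 \<le> length (path_edges xs)"
      then have "length xs \<le> 3" by (simp add: path_edges_length)
      then consider "xs = []" | x where "xs = [x]" | x y where "xs = [x, y]" | x y z where "xs = [x, y, z]"
        by (cases xs; cases "tl xs"; cases "tl (tl xs)") auto
      then show False
        using xs assms(2,3) B by cases (auto simp: is_path_def common_nbrs_def insert_commute)
    qed
  qed
  then show ?thesis by (simp add: numeral_eq_enat)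
qed

lemma rainbow_colouringI:
  assumes "\<And>u v. u \<in> V \<Longrightarrow> v \<in> V \<Longrightarrow> u \<noteq> v \<Longrightarrow> {u, v} \<notin> E \<Longrightarrow> \<exists>xs. rainbow_path V E c u v xs"
  shows "rainbow_colouring V E c"
  unfolding rainbow_colouring_def
proof (intro ballI)
  fix u v assume uv: "u \<in> V" "v \<in> V"
  consider "u = v" | "u \<noteq> v" "{u, v} \<in> E" | "u \<noteq> v" "{u, v} \<notin> E" by blast
  then show "\<exists>xs. rainbow_path V E c u v xs"
  proof cases
    case 1
    then have "rainbow_path V E c u v [u]" using uv by (simp add: rainbow_path_def is_path_def)
    then show ?thesis ..
  next
    case 2
    then have "rainbow_path V E c u v [u, v]" using uv by (simp add: rainbow_path_def is_path_def)
    then show ?thesis ..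
  qed (use uv assms in auto)
qed

text \<open>
  The two residue classes make every path \<open>u, a, b, v\<close> with \<open>a\<close>, \<open>b\<close> in them rainbow for the
  colouring \<open>{x, y} \<mapsto> (x + y) mod 3\<close>. They exist because three distinct colours sum to \<open>0\<close>, which
  forces \<open>{a, b}\<close> to have colour \<open>u + v\<close>; swapping the other two colours separates the classes.
\<close>

lemma residues_for_rainbow:
  fixes u v :: nat
  obtains \<alpha> \<beta> :: nat where "\<alpha> < 3" "\<beta> < 3" "\<alpha> \<noteq> \<beta>"
    "\<And>a b. a mod 3 = \<alpha> \<Longrightarrow> b mod 3 = \<beta> \<Longrightarrow> distinct [(u + a) mod 3, (a + b) mod 3, (b + v) mod 3]"
proof -
  have "\<forall>r\<in>{0, 1, 2}. \<forall>s\<in>{0, 1, 2}. \<exists>\<alpha>\<in>{0, 1, 2}. \<exists>\<beta>\<in>{0, 1, 2}. \<alpha> \<noteq> \<beta> \<and>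
    distinct [(r + \<alpha>) mod 3, (\<alpha> + \<beta>) mod 3, (\<beta> + s) mod (3::nat)]"
    by simp
  moreover have "u mod 3 \<in> {0, 1, 2}" "v mod 3 \<in> {0, 1, 2}" by auto
  ultimately obtain \<alpha> \<beta> where *: "\<alpha> \<in> {0, 1, 2}" "\<beta> \<in> {0, 1, 2}" "\<alpha> \<noteq> \<beta>"
    "distinct [(u mod 3 + \<alpha>) mod 3, (\<alpha> + \<beta>) mod 3, (\<beta> + v mod 3) mod (3::nat)]" by meson
  show ?thesis
  proof (rule that[of \<alpha> \<beta>])
    fix a b :: nat assume "a mod 3 = \<alpha>" "b mod 3 = \<beta>"
    then show "distinct [(u + a) mod 3, (a + b) mod 3, (b + v) mod 3]"
      using *(4) by (auto simp: mod_simps)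
  qed (use *(1-3) in auto)
qed

lemma rainbow_connection_le_3:
  fixes E :: "nat set set"
  assumes "\<And>u v. u \<in> V \<Longrightarrow> v \<in> V \<Longrightarrow> u \<noteq> v \<Longrightarrow> \<exists>a\<in>V - {u, v}. \<exists>b\<in>V - {u, v}. a \<noteq> b \<and>
      {u, a} \<in> E \<and> {a, b} \<in> E \<and> {b, v} \<in> E \<and> distinct [(u + a) mod 3, (a + b) mod 3, (b + v) mod 3]"
  shows "rainbow_connection V E \<le> 3"
proof -
  have "rainbow_colouring V E (\<lambda>e. \<Sum>e mod 3)"
  proof (rule rainbow_colouringI)
    fix u v assume uv: "u \<in> V" "v \<in> V" "u \<noteq> v"
    obtain a b where "a \<in> V - {u, v}" "b \<in> V - {u, v}" "a \<noteq> b"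
      "{u, a} \<in> E" "{a, b} \<in> E" "{b, v} \<in> E" "distinct [(u + a) mod 3, (a + b) mod 3, (b + v) mod 3]"
      using assms[OF uv] by blast
    then have "rainbow_path V E (\<lambda>e. \<Sum>e mod 3) u v [u, a, b, v]"
      using uv by (auto simp: rainbow_path_def is_path_def)
    then show "\<exists>xs. rainbow_path V E (\<lambda>e. \<Sum>e mod 3) u v xs" ..
  qed
  then have "rainbow_connection V E \<le> enat 3"
    by (intro rainbow_connection_le) auto
  then show ?thesis by (simp add: numeral_eq_enat)
qed

section \<open>Two colours from the local lemma\<close>

text \<open>
  The constants have to satisfy three constraints. The weight \<open>\<theta> = 11/20\<close> and the slack \<open>\<eta> = 1/1000\<close>
  need \<open>1/2 < \<theta> (1 - 2 \<eta>)\<^sup>2\<close>; beyond the threshold \<open>20\<close> the gain in this inequality absorbs two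
  factors \<open>1 - \<theta>\<close> coming from small pairs; and \<open>3 \<theta>\<^sup>2\<^sup>0 / \<eta>\<close> must be small enough for the union
  bound over edges.
\<close>

definition small_pair :: "'a set \<Rightarrow> 'a set set \<Rightarrow> 'a set \<Rightarrow> bool" where
  "small_pair V E B \<longleftrightarrow> B \<in> nsets V 2 \<and> card (common_nbrs V E B) \<le> 20"

text \<open>
  The paths \<open>b, w, b'\<close> of two pairs \<open>{b, b'}\<close> can share an edge only if both pairs touch each
  end of that edge.
\<close>

definition touches :: "'a set set \<Rightarrow> 'a set \<Rightarrow> 'a \<Rightarrow> bool" where
  "touches E B u \<longleftrightarrow> u \<in> B \<or> (\<forall>b\<in>B. {u, b} \<in> E)"

text \<open>An index lying in several \<open>J s\<close> has its factor repeated on the left, which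
  can only lower a product of numbers in \<open>[0, 1]\<close>.\<close>

lemma prod_UN_ge:
  fixes f :: "'a \<Rightarrow> real"
  assumes "finite S" "\<And>s. s \<in> S \<Longrightarrow> finite (J s)" "\<And>x. x \<in> (\<Union>s\<in>S. J s) \<Longrightarrow> 0 \<le> f x \<and> f x \<le> 1"
  shows "(\<Prod>s\<in>S. \<Prod>x\<in>J s. f x) \<le> (\<Prod>x\<in>(\<Union>s\<in>S. J s). f x)"
  using assms
proof (induction S rule: finite_induct)
  case empty
  then show ?case by simp
next
  case (insert s S)
  let ?U = "\<Union>s\<in>S. J s"
  have fin: "finite ?U" "finite (J s)" using insert by auto
  have "(\<Prod>s\<in>insert s S. \<Prod>x\<in>J s. f x) = (\<Prod>x\<in>J s. f x) * (\<Prod>s\<in>S. \<Prod>x\<in>J s. f x)"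
    using insert by simp
  also have "\<dots> \<le> (\<Prod>x\<in>J s. f x) * (\<Prod>x\<in>?U. f x)"
    using insert by (intro mult_left_mono prod_nonneg) auto
  also have "\<dots> \<le> (\<Prod>x\<in>J s. f x) * (\<Prod>x\<in>?U - J s. f x)"
  proof (intro mult_left_mono prod_nonneg)
    have "(\<Prod>x\<in>?U. f x) = (\<Prod>x\<in>?U - J s. f x) * (\<Prod>x\<in>?U \<inter> J s. f x)"
      using fin by (subst prod.subset_diff[of "?U \<inter> J s"]) (auto intro!: arg_cong2[where f = "(*)"] prod.cong)
    also have "\<dots> \<le> (\<Prod>x\<in>?U - J s. f x) * 1"
      using insert.prems by (intro mult_left_mono prod_le_1 prod_nonneg) auto
    finally show "(\<Prod>x\<in>?U. f x) \<le> (\<Prod>x\<in>?U - J s. f x)" by simp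
  qed (use insert in auto)
  also have "\<dots> = (\<Prod>x\<in>J s \<union> (?U - J s). f x)"
    using fin by (subst prod.union_disjoint) auto
  also have "J s \<union> (?U - J s) = (\<Union>s\<in>insert s S. J s)" by auto
  finally show ?case .
qed

lemma prob_fair_coins_agree:
  assumes "finite X" "e \<in> X" "e' \<in> X" "e \<noteq> e'"
  shows "measure_pmf.prob (Pi_pmf X False (\<lambda>_. bernoulli_pmf (1/2))) {g. g e = g e'} = 1/2"
proof -
  let ?P = "\<lambda>Q. measure_pmf.prob (Pi_pmf X False (\<lambda>_. bernoulli_pmf (1/2))) {g. Q g}"
  have t: "?P (\<lambda>g. g x) = 1/2" if "x \<in> X" for x
    using prob_component[OF assms(1) that, of "\<lambda>_. bernoulli_pmf (1/2)"] by simp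
  have f: "?P (\<lambda>g. \<not> g x) = 1/2" if "x \<in> X" for x
    using measure_pmf.prob_compl[of "{g. g x}" "Pi_pmf X False (\<lambda>_. bernoulli_pmf (1/2))"] t[OF that]
    by (simp add: Collect_neg_eq Compl_eq_Diff_UNIV)
  have 1: "?P (\<lambda>g. g e \<and> g e') = 1/4"
    using assms by (subst prob_indep[where D = "{e}" and D' = "{e'}"]) (auto simp: t intro: depends_onI)
  have 2: "?P (\<lambda>g. \<not> g e \<and> \<not> g e') = 1/4"
    using assms by (subst prob_indep[where D = "{e}" and D' = "{e'}"]) (auto simp: f intro: depends_onI)
  have "{g. g e = g e'} = {g. g e \<and> g e'} \<union> {g. \<not> g e \<and> \<not> g e'}" by auto
  then show ?thesis
    using 1 2 by (simp add: measure_pmf.finite_measure_Union disjoint_iff)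
qed

text \<open>
  The bad event of a pair with \<open>k\<close> common neighbours has probability \<open>2\<^sup>-\<^sup>k\<close> and gets weight
  \<open>\<theta>\<^sup>k\<close> in the local lemma. A small pair has no small neighbour in the dependency graph, any other
  pair has at most two.
\<close>

lemma two_colouring_exists:
  fixes V :: "'a set"
  assumes "finite V" and E: "E \<subseteq> nsets V 2"
    and cover: "\<And>B. B \<in> nsets V 2 \<Longrightarrow> B \<notin> E \<Longrightarrow> common_nbrs V E B \<noteq> {}"
    and T: "\<And>u B B'. u \<in> V \<Longrightarrow> small_pair V E B \<Longrightarrow> small_pair V E B' \<Longrightarrow>
      touches E B u \<Longrightarrow> touches E B' u \<Longrightarrow> B = B'"
    and S: "\<And>u w. {u, w} \<in> E \<Longrightarrow>
      (\<Sum>x\<in>{x\<in>V. x \<noteq> u \<and> {u, x} \<notin> E \<and> {w, x} \<in> E \<and> 20 < card (common_nbrs V E {u, x})}.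
        (11/20) ^ card (common_nbrs V E {u, x})) \<le> (1/1000 :: real)"
  shows "\<exists>g :: 'a set \<Rightarrow> bool. \<forall>B\<in>nsets V 2. B \<notin> E \<longrightarrow>
    (\<exists>w\<in>common_nbrs V E B. \<exists>b\<in>B. \<exists>b'\<in>B. g {b, w} \<noteq> g {b', w})"
proof -
  define cn where "cn = common_nbrs V E"
  define I where "I = {B \<in> nsets V 2. B \<notin> E}"
  define D where "D B = (\<Union>w\<in>cn B. (\<lambda>b. {b, w}) ` B)" for B
  define P where "P B g \<longleftrightarrow> (\<forall>w\<in>cn B. \<forall>b\<in>B. \<forall>b'\<in>B. g {b, w} = g {b', w})" for B and g :: "'a set \<Rightarrow> bool"
  define x :: "'a set \<Rightarrow> real" where "x B = (11/20) ^ card (cn B)" for B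
  have finE: "finite E" using E \<open>finite V\<close> finite_subset finite_imp_finite_nsets by blast
  have finI: "finite I" using \<open>finite V\<close> by (simp add: I_def finite_imp_finite_nsets)
  have fincn: "finite (cn B)" for B using \<open>finite V\<close> by (simp add: cn_def common_nbrs_def)
  have edge: "{b, w} \<in> E" if "b \<in> B" "w \<in> cn B" for b w B
    using that by (auto simp: cn_def common_nbrs_def)
  have ne: "b \<noteq> w" "b \<in> V" "w \<in> V" if "{b, w} \<in> E" for b w
    using that E by (metis doubleton_in_nsets_2 subsetD)+
  have cn1: "card (cn B) \<ge> 1" if "B \<in> I" for B
    using cover[of B] that fincn[of B] by (auto simp: I_def cn_def Suc_le_eq card_gt_0_iff)
  have x01: "0 \<le> x B" "x B \<le> 11/20" if "B \<in> I" for B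
    unfolding x_def using power_decreasing[OF cn1[OF that], of "11/20 :: real"] by simp_all
  have prob: "measure_pmf.prob (Pi_pmf E False (\<lambda>_. bernoulli_pmf (1/2))) {g. P B g} = (1/2) ^ card (cn B)"
    if B: "B \<in> I" for B
  proof -
    obtain u v where uv: "B = {u, v}" "u \<noteq> v" using B by (auto simp: I_def elim!: nsets2_E)
    have "measure_pmf.prob (Pi_pmf E False (\<lambda>_. bernoulli_pmf (1/2))) {g. \<forall>w\<in>cn B. g {u, w} = g {v, w}} =
      (\<Prod>w\<in>cn B. measure_pmf.prob (Pi_pmf E False (\<lambda>_. bernoulli_pmf (1/2))) {g. g {u, w} = g {v, w}})"
    proof (rule prob_all_indep[OF finE fincn, where D = "\<lambda>w. {{u, w}, {v, w}}"])
      show "depends_on {{u, w}, {v, w}} (\<lambda>g. g {u, w} = g {v, w})" for w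
        by (rule depends_onI) simp
      fix w w' assume "w \<in> cn B" "w' \<in> cn B" "w \<noteq> w'"
      moreover have "u \<noteq> z \<and> v \<noteq> z" if "z \<in> cn B" for z
        using ne(1)[OF edge[of u B z]] ne(1)[OF edge[of v B z]] that uv by blast
      ultimately show "{{u, w}, {v, w}} \<inter> {{u, w'}, {v, w'}} = {}"
        by (simp add: doubleton_eq_iff)
    qed
    also have "\<dots> = (\<Prod>w\<in>cn B. 1/2)"
      by (intro prod.cong refl prob_fair_coins_agree finE)
        (use edge[of _ B] uv in \<open>auto simp: doubleton_eq_iff\<close>)
    also have "{g. \<forall>w\<in>cn B. g {u, w} = g {v, w}} = {g. P B g}"
      by (auto simp: P_def uv)
    finally show ?thesis by simp
  qed
  \<comment> \<open>The large pairs whose event reads the edge \<open>{b, w}\<close> with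
    \<open>b\<close> as an end and \<open>w\<close> as the middle vertex of the path;
    \<open>J w b\<close> collects those with the roles exchanged.\<close>
  define J where "J b w = {j\<in>I. 20 < card (cn j) \<and> b \<in> j \<and> w \<in> cn j}" for b w
  have Jsum: "sum x (J b w) \<le> 1/1000" if "{b, w} \<in> E" for b w
  proof -
    let ?S = "{y\<in>V. y \<noteq> b \<and> {b, y} \<notin> E \<and> {w, y} \<in> E \<and> 20 < card (common_nbrs V E {b, y})}"
    have "J b w \<subseteq> (\<lambda>y. {b, y}) ` ?S"
    proof
      fix j assume j: "j \<in> J b w"
      then obtain y where y: "j = {b, y}" "y \<noteq> b" "y \<in> V"
        by (auto simp: J_def I_def elim!: nsets2_E)
      moreover have "{w, y} \<in> E" using edge[of y j w] j y by (auto simp: J_def insert_commute)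
      ultimately have "y \<in> ?S" using j by (auto simp: J_def I_def cn_def)
      then show "j \<in> (\<lambda>y. {b, y}) ` ?S" using y by blast
    qed
    then have "sum x (J b w) \<le> sum x ((\<lambda>y. {b, y}) ` ?S)"
      using \<open>finite V\<close> by (intro sum_mono2) (auto simp: x_def)
    also have "\<dots> = (\<Sum>y\<in>?S. x {b, y})"
      by (subst sum.reindex) (auto simp: inj_on_def doubleton_eq_iff)
    also have "\<dots> \<le> 1/1000" using S[OF that] by (simp add: x_def cn_def)
    finally show ?thesis .
  qed
  have finJ: "finite (J b w)" for b w using finI by (simp add: J_def)
  \<comment> \<open>This is \<open>\<theta> (1 - 2 \<eta>)^2\<close>: each common neighbour of
    \<open>B\<close> brings two edges, and large pairs read an edge in two orientations, each of
    total weight at most \<open>\<eta>\<close>. What matters is that \<open>\<rho>\<close> exceeds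
    \<open>1/2\<close>.\<close>
  define \<rho> :: real where "\<rho> = 11/20 * (998/1000) ^ 2"
  have bound: "(1/2) ^ card (cn B) \<le> x B * (\<Prod>j\<in>{j\<in>I. j \<noteq> B \<and> D j \<inter> D B \<noteq> {}}. 1 - x j)"
    if B: "B \<in> I" for B
  proof -
    define N where "N = {j\<in>I. j \<noteq> B \<and> D j \<inter> D B \<noteq> {}}"
    define Ns where "Ns = {j\<in>N. card (cn j) \<le> 20}"
    define Nl where "Nl = {j\<in>N. 20 < card (cn j)}"
    define k where "k = card (cn B)"
    have finN: "finite N" "finite Ns" "finite Nl" using finI by (auto simp: N_def Ns_def Nl_def)
    have NI: "N \<subseteq> I" "Ns \<subseteq> I" "Nl \<subseteq> I" by (auto simp: N_def Ns_def Nl_def)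
    have cB: "card B = 2" "finite B" "B \<subseteq> V" using B by (auto simp: I_def nsets_def)
    \<comment> \<open>A common edge is read by \<open>j\<close> either with the same end and middle
      vertex as by \<open>B\<close>, or with these two roles exchanged.\<close>
    have shared: "\<exists>b\<in>B. \<exists>w\<in>cn B. b \<in> j \<and> w \<in> cn j \<or> w \<in> j \<and> b \<in> cn j" if "j \<in> N" for j
      using that unfolding N_def D_def by (fastforce simp: doubleton_eq_iff)
    have "(\<Prod>p\<in>B \<times> cn B. 998/1000) \<le> (\<Prod>p\<in>B \<times> cn B. \<Prod>j\<in>J (fst p) (snd p) \<union> J (snd p) (fst p). 1 - x j)"
    proof (rule prod_mono, safe)
      fix b w assume bw: "b \<in> B" "w \<in> cn B"
      have "sum x (J b w \<union> J w b) \<le> sum x (J b w) + sum x (J w b)"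
        using finJ by (subst sum.union_inter[symmetric]) (auto intro!: sum_nonneg simp: x_def)
      also have "\<dots> \<le> 1/1000 + 1/1000"
        using Jsum edge[OF bw] by (intro add_mono) (auto simp: insert_commute)
      finally have "998/1000 \<le> 1 - sum x (J b w \<union> J w b)" by simp
      also have "\<dots> \<le> (\<Prod>j\<in>J b w \<union> J w b. 1 - x j)"
        using x01 by (intro Weierstrass_prod_ineq) (force simp: J_def)
      finally show "998/1000 \<le> (\<Prod>j\<in>J (fst (b, w)) (snd (b, w)) \<union> J (snd (b, w)) (fst (b, w)). 1 - x j)"
        by simp
    qed simp
    also have "\<dots> \<le> (\<Prod>j\<in>(\<Union>p\<in>B \<times> cn B. J (fst p) (snd p) \<union> J (snd p) (fst p)). 1 - x j)"
      using cB fincn finJ x01 by (intro prod_UN_ge) (force simp: J_def)+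
    also have "\<dots> \<le> (\<Prod>j\<in>Nl. 1 - x j)"
    proof -
      let ?U = "\<Union>p\<in>B \<times> cn B. J (fst p) (snd p) \<union> J (snd p) (fst p)"
      have sub: "Nl \<subseteq> ?U"
        using shared NI by (fastforce simp: Nl_def J_def)
      have UI: "?U \<subseteq> I" by (auto simp: J_def)
      have fU: "finite ?U" using UI finI finite_subset by blast
      have "(\<Prod>j\<in>?U. 1 - x j) = (\<Prod>j\<in>?U - Nl. 1 - x j) * (\<Prod>j\<in>Nl. 1 - x j)"
        by (rule prod.subset_diff[OF sub fU])
      also have "\<dots> \<le> 1 * (\<Prod>j\<in>Nl. 1 - x j)"
      proof (intro mult_right_mono prod_le_1 prod_nonneg)
        show "0 \<le> 1 - x j \<and> 1 - x j \<le> 1" if "j \<in> ?U - Nl" for j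
          using x01[of j] UI that by force
        show "0 \<le> 1 - x j" if "j \<in> Nl" for j
          using x01[of j] NI that by force
      qed
      finally show ?thesis by simp
    qed
    also have "(\<Prod>p\<in>B \<times> cn B. 998/1000) = ((998/1000) ^ 2) ^ k"
      by (simp add: card_cartesian_product cB k_def power_mult)
    finally have large: "((998/1000) ^ 2) ^ k \<le> (\<Prod>j\<in>Nl. 1 - x j)" .
    have tj: "\<exists>b\<in>B. touches E j b" "small_pair V E j" "j \<noteq> B" if "j \<in> Ns" for j
    proof -
      have "j \<in> N" using that by (simp add: Ns_def)
      from shared[OF this] show "\<exists>b\<in>B. touches E j b"
        by (auto simp: touches_def cn_def common_nbrs_def insert_commute)
    qed (use that in \<open>auto simp: Ns_def N_def I_def small_pair_def cn_def\<close>)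
    \<comment> \<open>A pair in \<open>I\<close> has at least one common neighbour, hence weight at
      most \<open>11/20\<close>.\<close>
    have small: "(9/20) ^ card Ns \<le> (\<Prod>j\<in>Ns. 1 - x j)"
      using x01 NI prod_mono[of Ns "\<lambda>_. 9/20" "\<lambda>j. 1 - x j"] by force
    have ex: "\<exists>j. {j\<in>Ns. touches E j b} \<subseteq> {j}" if "b \<in> B" for b
      using T[of b] tj(2) that cB by (cases "{j\<in>Ns. touches E j b} = {}") blast+
    \<comment> \<open>Every small neighbour of \<open>B\<close> touches one of the two ends of
      \<open>B\<close>, and a vertex is touched by at most one small pair.\<close>
    have "card Ns \<le> 2"
    proof -
      have "Ns \<subseteq> (\<Union>b\<in>B. {j\<in>Ns. touches E j b})" using tj(1) by blast
      then have "card Ns \<le> card (\<Union>b\<in>B. {j\<in>Ns. touches E j b})"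
        using finN cB by (intro card_mono) auto
      also have "\<dots> \<le> (\<Sum>b\<in>B. card {j\<in>Ns. touches E j b})" using cB by (intro card_UN_le)
      also have "\<dots> \<le> (\<Sum>b\<in>B. 1)"
      proof (rule sum_mono)
        fix b assume "b \<in> B"
        then obtain j where "{j\<in>Ns. touches E j b} \<subseteq> {j}" using ex by blast
        then show "card {j\<in>Ns. touches E j b} \<le> 1" using card_mono[of "{j}"] by simp
      qed
      finally show ?thesis using cB by simp
    qed
    \<comment> \<open>A small \<open>B\<close> touches its own ends, which leaves no room for a
      second small pair touching one of them.\<close>
    moreover have "Ns = {}" if "k \<le> 20"
    proof -
      have "small_pair V E B" using that B by (auto simp: small_pair_def I_def k_def cn_def)
      then show ?thesis using tj T cB by (auto simp: touches_def) blast
    qed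
    ultimately have "(1/2) ^ k \<le> \<rho> ^ k * (9/20) ^ card Ns"
    proof (cases "k \<le> 20")
      case True
      then have "Ns = {}" by fact
      then show ?thesis by (auto simp: \<rho>_def power2_eq_square intro: power_mono)
    next
      case False
      \<comment> \<open>Here \<open>k\<close> is at least 21, and replacing 21 factors
        \<open>1/2\<close> by \<open>\<rho>\<close> gains more than \<open>(20/9)^2\<close>, the
        loss caused by two small neighbours.\<close>
      have "(1/2) ^ k = (1/2) ^ (k - 21) * (1/2 :: real) ^ 21"
        using False by (simp flip: power_add)
      also have "\<dots> \<le> \<rho> ^ (k - 21) * (\<rho> ^ 21 * (9/20) ^ 2)"
      proof (intro mult_mono power_mono)
        show "(1/2) ^ 21 \<le> \<rho> ^ 21 * (9/20) ^ 2"
          by (simp add: \<rho>_def power_divide power_mult_distrib)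
      qed (auto simp: \<rho>_def power2_eq_square)
      also have "\<dots> = \<rho> ^ k * (9/20) ^ 2" using False by (simp flip: mult.assoc power_add)
      also have "\<dots> \<le> \<rho> ^ k * (9/20) ^ card Ns"
        using \<open>card Ns \<le> 2\<close> by (intro mult_left_mono power_decreasing) (auto simp: \<rho>_def)
      finally show ?thesis .
    qed
    also have "\<rho> ^ k * (9/20) ^ card Ns = x B * (((998/1000) ^ 2) ^ k * (9/20) ^ card Ns)"
      unfolding x_def \<rho>_def k_def power_mult_distrib by simp
    also have "\<dots> \<le> x B * ((\<Prod>j\<in>Nl. 1 - x j) * (\<Prod>j\<in>Ns. 1 - x j))"
      using large small x01[OF B] by (intro mult_left_mono mult_mono) (auto intro: order_trans[rotated])
    also have "(\<Prod>j\<in>Nl. 1 - x j) * (\<Prod>j\<in>Ns. 1 - x j) = (\<Prod>j\<in>Nl \<union> Ns. 1 - x j)"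
      using finN by (subst prod.union_disjoint) (auto simp: Nl_def Ns_def)
    also have "Nl \<union> Ns = N" by (auto simp: Nl_def Ns_def)
    finally show ?thesis by (simp add: k_def N_def)
  qed
  have "\<exists>g. \<forall>B\<in>I. \<not> P B g"
  proof (rule lovasz_local_product[OF finE finI, where q = "\<lambda>_. bernoulli_pmf (1/2)"])
    show "depends_on (D B) (P B)" if "B \<in> I" for B
      unfolding P_def
    proof (rule depends_onI, intro ball_cong refl)
      fix g h :: "'a set \<Rightarrow> bool" and w b b'
      assume "\<And>e. e \<in> D B \<Longrightarrow> g e = h e" "w \<in> cn B" "b \<in> B" "b' \<in> B"
      then have "g {b, w} = h {b, w}" "g {b', w} = h {b', w}" by (auto simp: D_def)
      then show "(g {b, w} = g {b', w}) = (h {b, w} = h {b', w})" by simp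
    qed
    show "0 \<le> x B \<and> x B < 1" if "B \<in> I" for B using x01[OF that] by simp
  qed (simp add: prob bound)
  then obtain g where g: "\<And>B. B \<in> I \<Longrightarrow> \<not> P B g" by blast
  show ?thesis
  proof (intro exI[of _ g] ballI impI)
    fix B assume "B \<in> nsets V 2" "B \<notin> E"
    then have "\<not> P B g" by (intro g) (simp add: I_def)
    then show "\<exists>w\<in>common_nbrs V E B. \<exists>b\<in>B. \<exists>b'\<in>B. g {b, w} \<noteq> g {b', w}"
      by (simp add: P_def cn_def)
  qed
qed

lemma rainbow_connection_le_2:
  fixes g :: "'a set \<Rightarrow> bool"
  assumes "E \<subseteq> nsets V 2"
    and "\<And>B. B \<in> nsets V 2 \<Longrightarrow> B \<notin> E \<Longrightarrow> \<exists>w\<in>common_nbrs V E B. \<exists>b\<in>B. \<exists>b'\<in>B. g {b, w} \<noteq> g {b', w}"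
  shows "rainbow_connection V E \<le> 2"
proof -
  have "rainbow_colouring V E (\<lambda>e. of_bool (g e) :: nat)"
  proof (rule rainbow_colouringI)
    fix u v assume uv: "u \<in> V" "v \<in> V" "u \<noteq> v" "{u, v} \<notin> E"
    then obtain w where w: "w \<in> common_nbrs V E {u, v}" "g {u, w} \<noteq> g {v, w}"
      using assms(2)[of "{u, v}"] by auto
    then have E: "{u, w} \<in> E" "{w, v} \<in> E" by (auto simp: common_nbrs_def insert_commute)
    then have "u \<noteq> w" "w \<noteq> v" "w \<in> V" using assms(1) by (metis doubleton_in_nsets_2 subsetD)+
    then have "rainbow_path V E (\<lambda>e. of_bool (g e) :: nat) u v [u, w, v]"
      using uv E w(2) by (auto simp: rainbow_path_def is_path_def insert_commute)
    then show "\<exists>xs. rainbow_path V E (\<lambda>e. of_bool (g e) :: nat) u v xs" ..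
  qed
  then have "rainbow_connection V E \<le> enat 2"
    by (intro rainbow_connection_le) (auto simp: of_bool_def)
  then show ?thesis by (simp add: numeral_eq_enat)
qed

section \<open>Union bounds for the random graph\<close>

text \<open>From \<open>exp (- y) \<ge> 1 - y\<close>. It linearises the exponential moment of a
  variable with values in \<open>[0, m]\<close>.\<close>

lemma exp_le_one_plus_mult:
  fixes y m :: real
  assumes "0 \<le> y" "y \<le> m"
  shows "exp y \<le> 1 + exp m * y"
proof -
  have "exp y * (1 - y) \<le> exp y * exp (- y)"
    using exp_ge_add_one_self[of "- y"] by (intro mult_left_mono) auto
  then have "exp y \<le> 1 + exp y * y" by (simp add: algebra_simps flip: exp_add)
  also have "exp y * y \<le> exp m * y" using assms by (intro mult_right_mono) auto
  finally show ?thesis by simp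
qed

text \<open>Turns a geometric weight of a count into a product over coordinates, whose expectation
  factorises when these are independent.\<close>

lemma prod_one_minus_of_bool:
  fixes s :: real
  assumes "finite S"
  shows "(\<Prod>x\<in>S. 1 - s * of_bool (P x)) = (1 - s) ^ card {x\<in>S. P x}"
  using assms
proof (induction S rule: finite_induct)
  case (insert a S)
  have "{x \<in> insert a S. P x} = (if P a then insert a {x\<in>S. P x} else {x\<in>S. P x})" by auto
  then show ?case using insert by simp
qed simp

locale gnp =
  fixes n :: nat and p :: real
  assumes p01: "0 \<le> p" "p \<le> 1"
begin

abbreviation "V \<equiv> {..<n}"
abbreviation "K \<equiv> nsets {..<n} 2"
abbreviation "Pr Q \<equiv> measure_pmf.prob (Pi_pmf (nsets {..<n} 2) False (\<lambda>_. bernoulli_pmf p)) {g. Q g}"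
abbreviation "Exp f \<equiv> measure_pmf.expectation (Pi_pmf (nsets {..<n} 2) False (\<lambda>_. bernoulli_pmf p)) f"

definition G :: "(nat set \<Rightarrow> bool) \<Rightarrow> nat set set" where "G g = {e \<in> K. g e}"

lemma finK: "finite K" by (simp add: finite_imp_finite_nsets)

lemma Pr_mono: "(\<And>g. Q g \<Longrightarrow> R g) \<Longrightarrow> Pr Q \<le> Pr R"
  by (intro measure_pmf.finite_measure_mono) auto

lemma Pr_le_Exp:
  assumes "\<And>g. of_bool (Q g) \<le> f g" shows "Pr Q \<le> Exp f"
  unfolding expectation_of_bool[OF finK, symmetric] by (intro expectation_mono finK assms)

lemma Pr_not: "Pr (\<lambda>g. \<not> R g) = 1 - Pr R"
  using measure_pmf.prob_compl[of "{g. R g}" "Pi_pmf K False (\<lambda>_. bernoulli_pmf p)"]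
  by (simp add: Collect_neg_eq Compl_eq_Diff_UNIV)

lemma Pr_disj_le: "Pr (\<lambda>g. Q g \<or> R g) \<le> Pr Q + Pr R"
  unfolding Collect_disj_eq by (intro measure_Un_le) auto

lemma Pr_bex_le:
  fixes b :: real
  assumes "finite S" "\<And>i. i \<in> S \<Longrightarrow> Pr (Q i) \<le> b"
  shows "Pr (\<lambda>g. \<exists>i\<in>S. Q i g) \<le> card S * b"
proof -
  have "Pr (\<lambda>g. \<exists>i\<in>S. Q i g) = measure_pmf.prob (Pi_pmf K False (\<lambda>_. bernoulli_pmf p)) (\<Union>i\<in>S. {g. Q i g})"
    by (intro arg_cong[where f = "measure_pmf.prob _"]) auto
  also have "\<dots> \<le> (\<Sum>i\<in>S. Pr (Q i))"
    using assms(1) by (intro measure_pmf.finite_measure_subadditive_finite) auto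
  also have "\<dots> \<le> (\<Sum>i\<in>S. b)" by (intro sum_mono assms)
  finally show ?thesis by simp
qed

lemma Pr_present: "F \<subseteq> K \<Longrightarrow> Pr (\<lambda>g. \<forall>e\<in>F. g e) = p ^ card F"
  using p01 by (intro prob_all_present finK) auto

lemma Pr_edge: "e \<in> K \<Longrightarrow> Pr (\<lambda>g. g e) = p"
  using Pr_present[of "{e}"] by simp

lemma Exp_factor:
  fixes s :: real
  shows "e \<in> K \<Longrightarrow> Exp (\<lambda>g. 1 - s * of_bool (g e)) = 1 - s * p"
  by (simp add: Bochner_Integration.integral_diff integrable_Pi_bool finK expectation_of_bool Pr_edge)

text \<open>Markov's inequality for \<open>(1/2)^X\<close>, where \<open>X\<close> is the number of
  edges of \<open>F\<close> present; its expectation is \<open>(1 - p/2)^(card F)\<close>.\<close>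

lemma Pr_few_present:
  fixes m :: real
  assumes "F \<subseteq> K"
  shows "Pr (\<lambda>g. card {e\<in>F. g e} \<le> m) \<le> 2 powr m * exp (- p * card F / 2)"
proof -
  have fF: "finite F" using assms finK finite_subset by blast
  have "Pr (\<lambda>g. card {e\<in>F. g e} \<le> m) \<le> Exp (\<lambda>g. 2 powr m * (\<Prod>e\<in>F. 1 - 1/2 * of_bool (g e)))"
  proof (rule Pr_le_Exp)
    fix g :: "nat set \<Rightarrow> bool"
    have "1 \<le> 2 powr m * (1/2) ^ card {e\<in>F. g e}" if "card {e\<in>F. g e} \<le> m"
    proof -
      have "2 powr m * (1/2) ^ card {e\<in>F. g e} = 2 powr (m - card {e\<in>F. g e})"
        by (simp add: powr_diff powr_realpow power_divide)
      then show ?thesis using that ge_one_powr_ge_zero[of 2 "m - card {e\<in>F. g e}"] by simp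
    qed
    then show "of_bool (card {e\<in>F. g e} \<le> m) \<le> 2 powr m * (\<Prod>e\<in>F. 1 - 1/2 * of_bool (g e))"
      unfolding prod_one_minus_of_bool[OF fF] by simp
  qed
  also have "\<dots> = 2 powr m * Exp (\<lambda>g. \<Prod>e\<in>F. 1 - 1/2 * of_bool (g e))" by simp
  also have "Exp (\<lambda>g. \<Prod>e\<in>F. 1 - 1/2 * of_bool (g e)) = (\<Prod>e\<in>F. Exp (\<lambda>g. 1 - 1/2 * of_bool (g e)) :: real)"
    by (rule expectation_prod_indep[OF finK fF, where D = "\<lambda>e. {e}"]) (auto intro: depends_onI)
  also have "\<dots> = (\<Prod>e\<in>F. 1 - 1/2 * p :: real)" using assms by (intro prod.cong refl Exp_factor) auto
  also have "\<dots> \<le> (\<Prod>e\<in>F. exp (- p / 2))"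
    using p01 exp_ge_add_one_self[of "- p / 2"] by (intro prod_mono) auto
  also have "\<dots> = exp (- p * card F / 2)" by (simp flip: exp_of_nat_mult)
  finally show ?thesis by simp
qed

text \<open>Bounds the probability that two given distinct pairs are both small.
  \<open>20^40\<close> is the price of Markov's inequality with two counts of at most 20,
  \<open>19/10\<close> is twice \<open>19/20\<close>, the cubic term comes from vertices joined to
  both pairs, and 5 is the size of the largest configuration \<open>Z\<close> left out.\<close>

definition Q :: real where "Q = 20 ^ 40 * exp (- (real n - 5) * (19/10 * p\<^sup>2 - p ^ 3))"

text \<open>
  For \<open>z\<close> outside \<open>Z\<close> the events that \<open>z\<close> is joined to all of \<open>B\<close>, respectively all of \<open>B'\<close>, are
  independent over \<open>z\<close>, so the bound is the Chernoff bound for \<open>(1/20)\<^sup>X\<^sup>+\<^sup>Y\<close>.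
\<close>

lemma Pr_two_small:
  assumes Z: "Z \<subseteq> V" "card Z \<le> 5" and B: "B \<in> nsets Z 2" "B' \<in> nsets Z 2" "B \<noteq> B'" and F: "F \<subseteq> nsets Z 2"
  shows "Pr (\<lambda>g. (\<forall>e\<in>F. g e) \<and> small_pair V (G g) B \<and> small_pair V (G g) B') \<le> p ^ card F * Q"
proof -
  have finZ: "finite Z" using Z finite_subset by blast
  have FK: "F \<subseteq> K" using F nsets_mono[OF Z(1)] by blast
  define s :: real where "s = 19/20"
  define a where "a z C g \<longleftrightarrow> (\<forall>b\<in>C. g {b, z})" for z C and g :: "nat set \<Rightarrow> bool"
  define \<psi> where "\<psi> z g = (1 - s * of_bool (a z B g)) * (1 - s * of_bool (a z B' g))" for z g
  have sub: "B \<subseteq> Z" "B' \<subseteq> Z" "card B = 2" "card B' = 2" "finite B" "finite B'"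
    using B by (auto simp: nsets_def)
  have key: "1/20 ^ 20 \<le> (\<Prod>z\<in>V - Z. 1 - s * of_bool (a z C g))"
    if "C \<subseteq> Z" "card (common_nbrs V (G g) C) \<le> 20" for C g
  proof -
    have "{z \<in> V - Z. a z C g} \<subseteq> common_nbrs V (G g) C"
      using that Z(1) by (auto simp: a_def common_nbrs_def G_def)
    then have "card {z \<in> V - Z. a z C g} \<le> 20"
      using that(2) card_mono[of "common_nbrs V (G g) C"] by (auto simp: common_nbrs_def intro: order_trans)
    then have "(1 - s) ^ 20 \<le> (1 - s) ^ card {z \<in> V - Z. a z C g}"
      by (intro power_decreasing) (auto simp: s_def)
    then show ?thesis by (subst prod_one_minus_of_bool) (auto simp: s_def power_divide)
  qed
  have "Pr (\<lambda>g. (\<forall>e\<in>F. g e) \<and> small_pair V (G g) B \<and> small_pair V (G g) B') \<le>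
    Exp (\<lambda>g. of_bool (\<forall>e\<in>F. g e) * (20 ^ 40 * (\<Prod>z\<in>V - Z. \<psi> z g)))"
  proof (rule Pr_le_Exp)
    fix g :: "nat set \<Rightarrow> bool"
    have "0 \<le> (\<Prod>z\<in>V - Z. \<psi> z g)"
      by (intro prod_nonneg) (auto simp: \<psi>_def s_def)
    moreover have "1 \<le> 20 ^ 40 * (\<Prod>z\<in>V - Z. \<psi> z g)"
      if "small_pair V (G g) B" "small_pair V (G g) B'"
    proof -
      have "1 / 20 ^ 20 * (1 / 20 ^ 20) \<le> (\<Prod>z\<in>V - Z. \<psi> z g)"
        unfolding \<psi>_def prod.distrib
        by (intro mult_mono key sub) (use that in \<open>auto simp: small_pair_def s_def intro!: prod_nonneg\<close>)
      then show ?thesis by simp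
    qed
    ultimately show "of_bool ((\<forall>e\<in>F. g e) \<and> small_pair V (G g) B \<and> small_pair V (G g) B') \<le>
      of_bool (\<forall>e\<in>F. g e) * (20 ^ 40 * (\<Prod>z\<in>V - Z. \<psi> z g))" by auto
  qed
  also have "\<dots> = Exp (\<lambda>g. of_bool (\<forall>e\<in>F. g e)) * Exp (\<lambda>g. 20 ^ 40 * (\<Prod>z\<in>V - Z. \<psi> z g))"
  proof (rule expectation_mult_indep[OF finK])
    show "depends_on F (\<lambda>g. of_bool (\<forall>e\<in>F. g e) :: real)" by (rule depends_onI) simp
    show "depends_on (\<Union>z\<in>V - Z. (\<lambda>b. {b, z}) ` Z) (\<lambda>g. 20 ^ 40 * (\<Prod>z\<in>V - Z. \<psi> z g))"
    proof (rule depends_on_comp[where k = "\<lambda>x. 20 ^ 40 * x"], rule depends_on_prod, rule depends_onI)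
      fix z and g h :: "nat set \<Rightarrow> bool"
      assume "\<And>e. e \<in> (\<lambda>b. {b, z}) ` Z \<Longrightarrow> g e = h e"
      then have "a z B g = a z B h" "a z B' g = a z B' h" using sub by (auto simp: a_def)
      then show "\<psi> z g = \<psi> z h" by (simp add: \<psi>_def)
    qed
    \<comment> \<open>Edges of \<open>F\<close> stay inside \<open>Z\<close>, whereas the edges
      deciding the \<open>\<psi> z\<close> leave it.\<close>
    show "F \<inter> (\<Union>z\<in>V - Z. (\<lambda>b. {b, z}) ` Z) = {}" using F by (auto simp: nsets_def)
  qed
  also have "Exp (\<lambda>g. of_bool (\<forall>e\<in>F. g e)) = p ^ card F"
    using Pr_present[OF FK] by (simp add: expectation_of_bool finK)
  also have "Exp (\<lambda>g. 20 ^ 40 * (\<Prod>z\<in>V - Z. \<psi> z g)) = 20 ^ 40 * (\<Prod>z\<in>V - Z. Exp (\<psi> z))"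
  proof -
    have "Exp (\<lambda>g. \<Prod>z\<in>V - Z. \<psi> z g) = (\<Prod>z\<in>V - Z. Exp (\<psi> z))"
    proof (rule expectation_prod_indep[OF finK, where D = "\<lambda>z. (\<lambda>b. {b, z}) ` Z"])
      show "depends_on ((\<lambda>b. {b, z}) ` Z) (\<psi> z)" for z
      proof (rule depends_onI)
        fix g h :: "nat set \<Rightarrow> bool"
        assume "\<And>e. e \<in> (\<lambda>b. {b, z}) ` Z \<Longrightarrow> g e = h e"
        then have "a z B g = a z B h" "a z B' g = a z B' h" using sub by (auto simp: a_def)
        then show "\<psi> z g = \<psi> z h" by (simp add: \<psi>_def)
      qed
    qed (auto simp: doubleton_eq_iff)
    then show ?thesis by simp
  qed
  also have "(\<Prod>z\<in>V - Z. Exp (\<psi> z)) \<le> (\<Prod>z\<in>V - Z. exp (- (19/10 * p\<^sup>2 - p ^ 3)))"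
  proof (rule prod_mono, safe)
    fix z assume z: "z < n" "z \<notin> Z"
    have Ea: "Exp (\<lambda>g. of_bool (a z C g)) = p ^ card C" if "C \<subseteq> Z" for C
    proof -
      have "Exp (\<lambda>g. of_bool (a z C g)) = Pr (\<lambda>g. \<forall>e\<in>(\<lambda>b. {b, z}) ` C. g e)"
        by (simp add: expectation_of_bool finK a_def)
      also have "\<dots> = p ^ card ((\<lambda>b. {b, z}) ` C)"
        using z that Z(1) by (intro Pr_present image_subsetI) (auto simp: subset_iff)
      also have "card ((\<lambda>b. {b, z}) ` C) = card C"
        by (intro card_image) (auto simp: inj_on_def doubleton_eq_iff)
      finally show ?thesis .
    qed
    have "\<psi> z = (\<lambda>g. 1 - s * of_bool (a z B g) - s * of_bool (a z B' g) + s\<^sup>2 * of_bool (a z (B \<union> B') g))"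
      by (auto simp: \<psi>_def a_def fun_eq_iff algebra_simps power2_eq_square)
    then have "Exp (\<psi> z) = 1 - s * p\<^sup>2 - s * p\<^sup>2 + s\<^sup>2 * p ^ card (B \<union> B')"
      using sub Ea by (simp add: integrable_Pi_bool finK)
    \<comment> \<open>Two distinct pairs have at least three ends together, which makes the
      correlation term cubic in \<open>p\<close>.\<close>
    also have "3 \<le> card (B \<union> B')"
    proof -
      have "B' \<noteq> B \<union> B'" using sub B(3) by (metis card_subset_eq sup_ge1)
      then have "card B' < card (B \<union> B')" using sub by (intro psubset_card_mono) auto
      then show ?thesis using sub by simp
    qed
    then have "p ^ card (B \<union> B') \<le> p ^ 3" using p01 by (intro power_decreasing) auto
    then have "s\<^sup>2 * p ^ card (B \<union> B') \<le> 1 * p ^ 3"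
      using p01 by (intro mult_mono) (auto simp: s_def power2_eq_square)
    also have "1 - s * p\<^sup>2 - s * p\<^sup>2 + 1 * p ^ 3 \<le> exp (- (19/10 * p\<^sup>2 - p ^ 3))"
      using exp_ge_add_one_self[of "- (19/10 * p\<^sup>2 - p ^ 3)"] by (simp add: s_def algebra_simps)
    finally show "Exp (\<psi> z) \<le> exp (- (19/10 * p\<^sup>2 - p ^ 3))" by simp
    show "0 \<le> Exp (\<psi> z)"
      by (intro integral_nonneg_AE) (auto simp: \<psi>_def s_def)
  qed
  also have "\<dots> = exp (- (19/10 * p\<^sup>2 - p ^ 3)) ^ card (V - Z)" by simp
  also have "\<dots> = exp (- real (card (V - Z)) * (19/10 * p\<^sup>2 - p ^ 3))"
    by (simp add: algebra_simps flip: exp_of_nat_mult)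
  also have "\<dots> \<le> exp (- (real n - 5) * (19/10 * p\<^sup>2 - p ^ 3))"
  proof -
    have "real n - 5 \<le> card (V - Z)" using Z finZ by (simp add: card_Diff_subset)
    moreover have "0 \<le> 19/10 * p\<^sup>2 - p ^ 3"
      using mult_right_mono[of p "19/10" "p\<^sup>2"] p01 by (simp add: power3_eq_cube power2_eq_square)
    ultimately have "(real n - 5) * (19/10 * p\<^sup>2 - p ^ 3) \<le> card (V - Z) * (19/10 * p\<^sup>2 - p ^ 3)"
      by (rule mult_right_mono)
    then show ?thesis by (simp only: exp_le_cancel_iff mult_minus_left neg_le_iff_le)
  qed
  finally show ?thesis using p01 by (simp add: Q_def mult_left_mono)
qed

lemma Q_nonneg: "0 \<le> Q" by (simp add: Q_def)

lemma card_K: "card K \<le> n ^ 2"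
proof -
  have "card K = n choose 2" by simp
  also have "\<dots> = n * (n - 1) div 2" by (rule choose_two)
  also have "\<dots> \<le> n * (n - 1)" by (rule div_le_dividend)
  also have "\<dots> \<le> n ^ 2" by (simp add: power2_eq_square)
  finally show ?thesis .
qed

text \<open>Three configurations: the pairs intersect (three vertices); they are disjoint and
  \<open>u\<close> lies in one of them (four vertices, two forced edges); or \<open>u\<close> lies
  in neither (five vertices, four forced edges). As \<open>n p^2\<close> is only logarithmic, each
  count is \<open>n^3\<close> up to logarithms.\<close>

lemma Pr_touch:
  "Pr (\<lambda>g. \<exists>u\<in>V. \<exists>B B'. small_pair V (G g) B \<and> small_pair V (G g) B' \<and>
      touches (G g) B u \<and> touches (G g) B' u \<and> B \<noteq> B') \<le> (n ^ 3 + n ^ 4 * p\<^sup>2 + n ^ 5 * p ^ 4) * Q"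
proof -
  define sm where "sm g B = small_pair V (G g) B" for g B
  \<comment> \<open>Here \<open>u\<close> is the common end of the two pairs, not the touched
    vertex.\<close>
  define E1 where "E1 = (\<lambda>(u, v, v') g. u \<noteq> v \<and> u \<noteq> v' \<and> v \<noteq> v' \<and> sm g {u, v} \<and> sm g {u, v'})"
  define E2 where "E2 = (\<lambda>(u, v, B') g. u \<noteq> v \<and> u \<notin> B' \<and> (\<forall>b\<in>B'. g {u, b}) \<and> sm g {u, v} \<and> sm g B')"
  define E3 where "E3 = (\<lambda>(u, B, B') g. u \<notin> B \<union> B' \<and> B \<inter> B' = {} \<and> (\<forall>b\<in>B \<union> B'. g {u, b}) \<and> sm g B \<and> sm g B')"
  have 1: "Pr (\<lambda>g. \<exists>i\<in>V \<times> V \<times> V. E1 i g) \<le> card (V \<times> V \<times> V) * Q"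
  proof (intro Pr_bex_le; clarsimp?)
    fix u v v' assume *: "u < n" "v < n" "v' < n"
    show "Pr (E1 (u, v, v')) \<le> Q"
    proof (cases "u \<noteq> v \<and> u \<noteq> v' \<and> v \<noteq> v'")
      case True
      have "Pr (\<lambda>g. (\<forall>e\<in>{}. g e) \<and> small_pair V (G g) {u, v} \<and> small_pair V (G g) {u, v'}) \<le> p ^ card ({} :: nat set set) * Q"
        by (rule Pr_two_small[where Z = "{u, v, v'}"]) (use True * in \<open>auto simp: doubleton_eq_iff\<close>)
      then show ?thesis using True by (simp add: E1_def sm_def)
    next
      case False
      then show ?thesis using Q_nonneg by (auto simp: E1_def)
    qed
  qed
  have 2: "Pr (\<lambda>g. \<exists>i\<in>V \<times> V \<times> K. E2 i g) \<le> card (V \<times> V \<times> K) * (p\<^sup>2 * Q)"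
  proof (intro Pr_bex_le; clarsimp?)
    show "finite (V \<times> V \<times> K)" using finK by auto
  next
    fix u v B assume *: "u < n" "v < n" "B \<in> K"
    show "Pr (E2 (u, v, B)) \<le> p\<^sup>2 * Q"
    proof (cases "u \<noteq> v \<and> u \<notin> B")
      case True
      obtain w y where B: "B = {w, y}" "w \<noteq> y" "w < n" "y < n" using * by (auto elim!: nsets2_E)
      have "Pr (\<lambda>g. (\<forall>e\<in>{{u, w}, {u, y}}. g e) \<and> small_pair V (G g) {u, v} \<and> small_pair V (G g) {w, y})
        \<le> p ^ card {{u, w}, {u, y}} * Q"
        by (rule Pr_two_small[where Z = "{u, v, w, y}"])
          (use True B * in \<open>auto simp: doubleton_eq_iff card_insert_if\<close>)
      then show ?thesis using True B by (simp add: E2_def sm_def doubleton_eq_iff conj_ac card_insert_if power2_eq_square)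
    next
      case False
      then show ?thesis using Q_nonneg by (auto simp: E2_def)
    qed
  qed
  have 3: "Pr (\<lambda>g. \<exists>i\<in>V \<times> K \<times> K. E3 i g) \<le> card (V \<times> K \<times> K) * (p ^ 4 * Q)"
  proof (intro Pr_bex_le; clarsimp?)
    show "finite (V \<times> K \<times> K)" using finK by auto
  next
    fix u B B' assume *: "u < n" "B \<in> K" "B' \<in> K"
    show "Pr (E3 (u, B, B')) \<le> p ^ 4 * Q"
    proof (cases "u \<notin> B \<union> B' \<and> B \<inter> B' = {}")
      case True
      have cB: "finite B" "card B = 2" "finite B'" "card B' = 2" "B \<subseteq> V" "B' \<subseteq> V"
        using * by (auto simp: nsets_def)
      have c4: "card (B \<union> B') = 4" using True cB by (simp add: card_Un_disjoint)
      have cF: "card ((\<lambda>b. {u, b}) ` (B \<union> B')) = 4"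
        unfolding c4[symmetric] by (intro card_image) (auto simp: inj_on_def doubleton_eq_iff)
      have "Pr (\<lambda>g. (\<forall>e\<in>(\<lambda>b. {u, b}) ` (B \<union> B'). g e) \<and> small_pair V (G g) B \<and> small_pair V (G g) B')
        \<le> p ^ card ((\<lambda>b. {u, b}) ` (B \<union> B')) * Q"
      proof (rule Pr_two_small[where Z = "insert u (B \<union> B')"])
        show "card (insert u (B \<union> B')) \<le> 5" using c4 cB by (simp add: card_insert_if)
        show "B \<noteq> B'" using True cB by auto
        show "(\<lambda>b. {u, b}) ` (B \<union> B') \<subseteq> nsets (insert u (B \<union> B')) 2" using True by auto
      qed (use * cB in \<open>auto simp: nsets_def\<close>)
      then show ?thesis unfolding cF using True by (simp add: E3_def sm_def)
    next
      case False
      then have "{g. E3 (u, B, B') g} = {}" by (auto simp: E3_def)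
      then show ?thesis using Q_nonneg p01 by simp
    qed
  qed
  have "Pr (\<lambda>g. \<exists>u\<in>V. \<exists>B B'. sm g B \<and> sm g B' \<and> touches (G g) B u \<and> touches (G g) B' u \<and> B \<noteq> B')
    \<le> Pr (\<lambda>g. (\<exists>i\<in>V \<times> V \<times> V. E1 i g) \<or> ((\<exists>i\<in>V \<times> V \<times> K. E2 i g) \<or> (\<exists>i\<in>V \<times> K \<times> K. E3 i g)))"
  proof (rule Pr_mono, elim bexE exE conjE)
    fix g u B B'
    assume u: "u \<in> V" and s: "sm g B" "sm g B'" and t: "touches (G g) B u" "touches (G g) B' u" and ne: "B \<noteq> B'"
    have K: "B \<in> K" "B' \<in> K" using s by (auto simp: sm_def small_pair_def)
    have t': "u \<in> B \<or> (u \<notin> B \<and> (\<forall>b\<in>B. g {u, b}))" "u \<in> B' \<or> (u \<notin> B' \<and> (\<forall>b\<in>B'. g {u, b}))"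
      using t by (auto simp: touches_def G_def)
    have e2: "\<exists>i\<in>V \<times> V \<times> K. E2 i g" if "C \<in> K" "C' \<in> K" "sm g C" "sm g C'" "u \<in> C" "u \<notin> C'" "\<forall>b\<in>C'. g {u, b}" for C C'
    proof -
      obtain v where "C = {u, v}" "u \<noteq> v" "v < n" using \<open>C \<in> K\<close> \<open>u \<in> C\<close> by (auto elim!: nsets2_E)
      then have "E2 (u, v, C') g" using that by (simp add: E2_def)
      then show ?thesis using u \<open>v < n\<close> that by (intro bexI[of _ "(u, v, C')"]) auto
    qed
    show "(\<exists>i\<in>V \<times> V \<times> V. E1 i g) \<or> ((\<exists>i\<in>V \<times> V \<times> K. E2 i g) \<or> (\<exists>i\<in>V \<times> K \<times> K. E3 i g))"
    proof (cases "B \<inter> B' = {}")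
      case False
      then obtain w where w: "w \<in> B" "w \<in> B'" by blast
      obtain y where y: "B = {w, y}" "w \<noteq> y" "y < n" "w < n" using K(1) w by (auto elim!: nsets2_E)
      obtain y' where y': "B' = {w, y'}" "w \<noteq> y'" "y' < n" using K(2) w by (auto elim!: nsets2_E)
      have "E1 (w, y, y') g" using y y' s ne by (auto simp: E1_def)
      then show ?thesis using y y' by (intro disjI1 bexI[of _ "(w, y, y')"]) auto
    next
      case True
      then consider "u \<in> B" "u \<notin> B'" | "u \<notin> B" "u \<in> B'" | "u \<notin> B" "u \<notin> B'" by blast
      then show ?thesis
      proof cases
        case 1
        then show ?thesis using e2[OF K s] t' by blast
      next
        case 2
        then show ?thesis using e2[OF K(2,1) s(2,1)] t' by blast
      next
        case 3
        then have "E3 (u, B, B') g" using t' s True by (auto simp: E3_def)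
        then show ?thesis using u K by (intro disjI2 bexI[of _ "(u, B, B')"]) auto
      qed
    qed
  qed
  also have "\<dots> \<le> Pr (\<lambda>g. \<exists>i\<in>V \<times> V \<times> V. E1 i g) + (Pr (\<lambda>g. \<exists>i\<in>V \<times> V \<times> K. E2 i g) + Pr (\<lambda>g. \<exists>i\<in>V \<times> K \<times> K. E3 i g))"
    by (intro order_trans[OF Pr_disj_le] add_left_mono Pr_disj_le)
  also have "\<dots> \<le> n ^ 3 * Q + (n ^ 4 * (p\<^sup>2 * Q) + n ^ 5 * (p ^ 4 * Q))"
  proof (intro add_mono)
    have c2: "real (card (V \<times> V \<times> K)) \<le> n ^ 4"
      using mult_left_mono[OF card_K, of "n * n"]
      by (simp add: card_cartesian_product power2_eq_square eval_nat_numeral mult.assoc flip: of_nat_mult of_nat_power)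
    have c3: "real (card (V \<times> K \<times> K)) \<le> n ^ 5"
      using mult_left_mono[OF mult_mono[OF card_K card_K], of n]
      by (simp add: card_cartesian_product power2_eq_square eval_nat_numeral mult.assoc flip: of_nat_mult of_nat_power)
    show "Pr (\<lambda>g. \<exists>i\<in>V \<times> V \<times> V. E1 i g) \<le> n ^ 3 * Q"
      using 1 by (simp add: card_cartesian_product power3_eq_cube mult.assoc)
    show "Pr (\<lambda>g. \<exists>i\<in>V \<times> V \<times> K. E2 i g) \<le> n ^ 4 * (p\<^sup>2 * Q)"
      using 2 mult_right_mono[OF c2, of "p\<^sup>2 * Q"] Q_nonneg by simp
    show "Pr (\<lambda>g. \<exists>i\<in>V \<times> K \<times> K. E3 i g) \<le> n ^ 5 * (p ^ 4 * Q)"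
      using 3 mult_right_mono[OF c3, of "p ^ 4 * Q"] Q_nonneg p01 by simp
  qed
  finally show ?thesis by (simp add: sm_def algebra_simps)
qed

text \<open>Expose the edges between \<open>B\<close> and \<open>v\<close> first. If
  \<open>v\<close> has at least 24 neighbours in \<open>B\<close>, each \<open>a\<close>
  independently fails to be adjacent both to \<open>u\<close> and to one of them; the disjointness
  of \<open>A\<close> and \<open>B\<close> keeps the edges involved fresh.\<close>

lemma Pr_no_three_path:
  assumes uv: "u \<in> V" "v \<in> V" "u \<noteq> v" and AB: "A \<subseteq> V - {u, v}" "B \<subseteq> V - {u, v}" "A \<inter> B = {}"
  shows "Pr (\<lambda>g. \<not> (\<exists>a\<in>A. \<exists>b\<in>B. g {u, a} \<and> g {a, b} \<and> g {b, v})) \<le>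
    2 ^ 24 * exp (- p * card B / 2) + (1 - p * (1 - (1 - p) ^ 24)) ^ card A"
proof -
  have fin: "finite A" "finite B" using AB finite_subset[of _ "V - {u, v}"] by auto
  define \<Phi> where "\<Phi> g = {b\<in>B. g {b, v}}" for g :: "nat set \<Rightarrow> bool"
  define H where "H d g \<longleftrightarrow> (\<forall>a\<in>A. \<not> (g {u, a} \<and> (\<exists>b\<in>d. g {a, b})))" for d and g :: "nat set \<Rightarrow> bool"
  \<comment> \<open>The number 24 makes the final exponent generous: for
    \<open>24 * p \<le> 1\<close> it gives success probability at least \<open>12 p^2\<close> for
    each \<open>a\<close>, so about \<open>n / 3\<close> candidates all fail with probability near
    \<open>n^(-8)\<close>, against \<open>n^2\<close> choices of \<open>u\<close>,
    \<open>v\<close>.\<close>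
  define good where "good d \<longleftrightarrow> d \<subseteq> B \<and> 24 \<le> card d" for d
  have 1: "Pr (\<lambda>g. good (\<Phi> g) \<and> H (\<Phi> g) g) \<le> (1 - p * (1 - (1 - p) ^ 24)) ^ card A"
  proof (rule prob_cond_le[OF finK])
    show "depends_on ((\<lambda>b. {b, v}) ` B) \<Phi>"
    proof (rule depends_onI)
      fix g h :: "nat set \<Rightarrow> bool" assume "\<And>e. e \<in> (\<lambda>b. {b, v}) ` B \<Longrightarrow> g e = h e"
      then show "\<Phi> g = \<Phi> h" unfolding \<Phi>_def by (intro Collect_cong conj_cong refl) auto
    qed
    fix d assume d: "good d"
    define S where "S a = insert {u, a} ((\<lambda>b. {a, b}) ` d)" for a
    have dep: "depends_on (S a) (\<lambda>g. \<not> (g {u, a} \<and> (\<exists>b\<in>d. g {a, b})))" for a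
      by (rule depends_onI) (auto simp: S_def)
    have dB: "d \<subseteq> V - {u, v}" "A \<inter> d = {}" "finite d" using d AB fin by (auto simp: good_def intro: finite_subset)
    show "depends_on (\<Union>a\<in>A. S a) (H d)"
      unfolding H_def
    proof (rule depends_onI, intro ball_cong refl)
      fix g h :: "nat set \<Rightarrow> bool" and a assume "\<And>e. e \<in> (\<Union>a\<in>A. S a) \<Longrightarrow> g e = h e" "a \<in> A"
      then show "(\<not> (g {u, a} \<and> (\<exists>b\<in>d. g {a, b}))) = (\<not> (h {u, a} \<and> (\<exists>b\<in>d. h {a, b})))"
        by (intro depends_onD[OF dep]) blast
    qed
    show "(\<lambda>b. {b, v}) ` B \<inter> (\<Union>a\<in>A. S a) = {}"
      using AB dB uv by (auto simp: S_def doubleton_eq_iff)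
    have nonadj: "Pr (\<lambda>g. \<forall>e\<in>F. \<not> g e) = (1 - p) ^ card F" if "F \<subseteq> K" for F
    proof -
      have neg: "Pr (\<lambda>g. \<not> g e) = 1 - p" if "e \<in> K" for e
        using Pr_edge[OF that] by (simp only: Pr_not)
      have "Pr (\<lambda>g. \<forall>e\<in>F. \<not> g e) = (\<Prod>e\<in>F. Pr (\<lambda>g. \<not> g e))"
        by (rule prob_all_indep[OF finK, where D = "\<lambda>e. {e}"])
          (use that finK finite_subset in \<open>auto intro: depends_onI\<close>)
      also have "\<dots> = (\<Prod>e\<in>F. 1 - p)" using that by (intro prod.cong refl neg) auto
      finally show ?thesis by simp
    qed
    have one: "Pr (\<lambda>g. \<not> (g {u, a} \<and> (\<exists>b\<in>d. g {a, b}))) = 1 - p * (1 - (1 - p) ^ card d)" if a: "a \<in> A" for a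
    proof -
      let ?F = "(\<lambda>b. {a, b}) ` d"
      have cF: "card ?F = card d" by (intro card_image) (auto simp: inj_on_def doubleton_eq_iff)
      have FK: "?F \<subseteq> K" using a AB dB by auto
      have "Pr (\<lambda>g. \<exists>b\<in>d. g {a, b}) = 1 - Pr (\<lambda>g. \<forall>e\<in>?F. \<not> g e)"
        by (subst measure_pmf.prob_compl[symmetric]) (auto intro!: arg_cong[where f = "measure_pmf.prob _"])
      then have ex: "Pr (\<lambda>g. \<exists>b\<in>d. g {a, b}) = 1 - (1 - p) ^ card d"
        using nonadj[OF FK] cF by simp
      have "Pr (\<lambda>g. g {u, a} \<and> (\<exists>b\<in>d. g {a, b})) = Pr (\<lambda>g. g {u, a}) * Pr (\<lambda>g. \<exists>b\<in>d. g {a, b})"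
      proof (rule prob_indep[OF finK])
        show "depends_on {{u, a}} (\<lambda>g. g {u, a})" by (rule depends_onI) simp
        show "depends_on ?F (\<lambda>g. \<exists>b\<in>d. g {a, b})" by (rule depends_onI) auto
        show "{{u, a}} \<inter> ?F = {}" using a AB dB by (auto simp: doubleton_eq_iff)
      qed
      also have "Pr (\<lambda>g. g {u, a}) = p" using a AB uv by (intro Pr_edge) auto
      finally have "Pr (\<lambda>g. g {u, a} \<and> (\<exists>b\<in>d. g {a, b})) = p * (1 - (1 - p) ^ card d)" by (simp add: ex)
      then show ?thesis by (simp only: Pr_not)
    qed
    have "Pr (H d) = (\<Prod>a\<in>A. Pr (\<lambda>g. \<not> (g {u, a} \<and> (\<exists>b\<in>d. g {a, b}))))"
      unfolding H_def
    proof (rule prob_all_indep[OF finK fin(1) dep])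
      fix a a' assume "a \<in> A" "a' \<in> A" "a \<noteq> a'"
      then show "S a \<inter> S a' = {}" using AB dB by (auto simp: S_def doubleton_eq_iff)
    qed
    also have "\<dots> = (1 - p * (1 - (1 - p) ^ card d)) ^ card A" using one by simp
    also have "\<dots> \<le> (1 - p * (1 - (1 - p) ^ 24)) ^ card A"
    proof (rule power_mono)
      have "(1 - p) ^ card d \<le> (1 - p) ^ 24"
        using d p01 by (intro power_decreasing) (auto simp: good_def)
      then show "1 - p * (1 - (1 - p) ^ card d) \<le> 1 - p * (1 - (1 - p) ^ 24)"
        using p01 by (simp add: mult_left_mono)
      have "p * (1 - (1 - p) ^ card d) \<le> 1 * 1"
        using p01 by (intro mult_mono) (auto simp: power_le_one)
      then show "0 \<le> 1 - p * (1 - (1 - p) ^ card d)" by simp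
    qed
    finally show "Pr (H d) \<le> (1 - p * (1 - (1 - p) ^ 24)) ^ card A" .
  next
    have "p * (1 - (1 - p) ^ 24) \<le> 1 * 1" using p01 by (intro mult_mono) (auto simp: power_le_one)
    then show "0 \<le> (1 - p * (1 - (1 - p) ^ 24)) ^ card A" by simp
  qed
  have "Pr (\<lambda>g. \<not> (\<exists>a\<in>A. \<exists>b\<in>B. g {u, a} \<and> g {a, b} \<and> g {b, v})) \<le>
    Pr (\<lambda>g. card {e\<in>(\<lambda>b. {b, v}) ` B. g e} \<le> real 24 \<or> good (\<Phi> g) \<and> H (\<Phi> g) g)"
  proof (rule Pr_mono)
    fix g assume no: "\<not> (\<exists>a\<in>A. \<exists>b\<in>B. g {u, a} \<and> g {a, b} \<and> g {b, v})"
    have "{e\<in>(\<lambda>b. {b, v}) ` B. g e} = (\<lambda>b. {b, v}) ` \<Phi> g" by (auto simp: \<Phi>_def)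
    also have "card \<dots> = card (\<Phi> g)" by (intro card_image) (auto simp: inj_on_def doubleton_eq_iff)
    finally show "card {e\<in>(\<lambda>b. {b, v}) ` B. g e} \<le> real 24 \<or> good (\<Phi> g) \<and> H (\<Phi> g) g"
      using no by (auto simp: good_def \<Phi>_def H_def)
  qed
  also have "\<dots> \<le> 2 powr real 24 * exp (- p * card ((\<lambda>b. {b, v}) ` B) / 2) + (1 - p * (1 - (1 - p) ^ 24)) ^ card A"
    by (intro order_trans[OF Pr_disj_le] add_mono 1 Pr_few_present) (use AB uv in auto)
  also have "card ((\<lambda>b. {b, v}) ` B) = card B" by (intro card_image) (auto simp: inj_on_def doubleton_eq_iff)
  also have "(2 :: real) powr real 24 = 2 ^ 24" by (rule powr_realpow) simp
  finally show ?thesis .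
qed

text \<open>The total local lemma weight of the large pairs that read the edge \<open>{u, w}\<close>
  through a path \<open>u, w, x\<close>, as bounded in a hypothesis of
  \<open>two_colouring_exists\<close>.\<close>

definition heavy_sum :: "nat set set \<Rightarrow> nat \<Rightarrow> nat \<Rightarrow> real" where
  "heavy_sum E u w = (\<Sum>x\<in>{x\<in>V. x \<noteq> u \<and> {u, x} \<notin> E \<and> {w, x} \<in> E \<and> 20 < card (common_nbrs V E {u, x})}.
        (11/20) ^ card (common_nbrs V E {u, x}))"

text \<open>
  Given the neighbourhood \<open>d\<close> of \<open>u\<close>, the summands belonging to distinct \<open>x \<notin> d\<close> depend on disjoint sets
  of edges, so the exponential moment of the sum factorises.
\<close>

lemma Pr_heavy_sum:
  fixes \<kappa> :: real
  assumes uw: "u \<in> V" "w \<in> V" "u \<noteq> w" and \<kappa>: "0 \<le> \<kappa>"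
  shows "Pr (\<lambda>g. g {u, w} \<and> 1/1000 < heavy_sum (G g) u w) \<le>
    2 powr (7/10 * n * p) * exp (- p * (real n - 1) / 2) +
    exp (- \<kappa> / 1000) * exp (n * (\<kappa> * exp (\<kappa> * (11/20) ^ 20) * (p * exp (- (9/20) * p * (7/10 * n * p - 1)))))"
proof -
  define \<theta> :: real where "\<theta> = 11/20"
  define W where "W = V - {u}"
  define c where "c = \<kappa> * exp (\<kappa> * \<theta> ^ 20)"
  define \<mu> where "\<mu> = p * exp (- (9/20) * p * (7/10 * n * p - 1))"
  define \<Phi> where "\<Phi> g = {z\<in>W. g {u, z}}" for g :: "nat set \<Rightarrow> bool"
  \<comment> \<open>The cap \<open>\<theta>^20\<close> is justified because only pairs with more
    than 20 common neighbours are summed, and it keeps the exponential moment under control for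
    large \<open>\<kappa>\<close>. Removing \<open>w\<close> from the count makes the two factors
    depend on different edges.\<close>
  define Y where "Y d x g = of_bool (g {w, x}) * min (\<theta> ^ 20) (\<theta> ^ card {z\<in>d - {w}. g {z, x}})"
    for d x and g :: "nat set \<Rightarrow> bool"
  define H where "H d g \<longleftrightarrow> 1/1000 < (\<Sum>x\<in>W - d. Y d x g)" for d and g :: "nat set \<Rightarrow> bool"
  \<comment> \<open>The fraction \<open>7/10\<close> meets two demands: it is below
    \<open>1 / (2 ln 2)\<close>, so that a smaller degree of \<open>u\<close> is very unlikely, and
    \<open>9/20 * 7/10 * 199/100\<close> is above \<open>1/2\<close>, so that the expected sum tends
    to 0.\<close>
  define good where "good d \<longleftrightarrow> d \<subseteq> W \<and> w \<in> d \<and> 7/10 * n * p \<le> card d" for d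
  have \<theta>: "0 < \<theta>" "\<theta> < 1" by (auto simp: \<theta>_def)
  have c0: "0 \<le> c" using \<kappa> by (simp add: c_def)
  have \<mu>0: "0 \<le> \<mu>" using p01 by (simp add: \<mu>_def)
  have finW: "finite W" by (simp add: W_def)
  have 1: "Pr (\<lambda>g. good (\<Phi> g) \<and> H (\<Phi> g) g) \<le> exp (- \<kappa> / 1000) * exp (n * (c * \<mu>))"
  proof (rule prob_cond_le[OF finK])
    show "depends_on ((\<lambda>z. {u, z}) ` W) \<Phi>"
    proof (rule depends_onI)
      fix g h :: "nat set \<Rightarrow> bool" assume "\<And>e. e \<in> (\<lambda>z. {u, z}) ` W \<Longrightarrow> g e = h e"
      then show "\<Phi> g = \<Phi> h" unfolding \<Phi>_def by (intro Collect_cong conj_cong refl) auto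
    qed
    fix d assume d: "good d"
    have dW: "d \<subseteq> W" "w \<in> d" "7/10 * n * p \<le> card d" "finite d"
      using d finW by (auto simp: good_def intro: finite_subset)
    define S where "S x = (\<lambda>z. {z, x}) ` d" for x
    have disjS: "S x \<inter> S y = {}" if "x \<in> W - d" "y \<in> W - d" "x \<noteq> y" for x y
      using that by (auto simp: S_def doubleton_eq_iff)
    have depY: "depends_on (S x) (Y d x)" for x
    proof (rule depends_onI)
      fix g h :: "nat set \<Rightarrow> bool" assume "\<And>e. e \<in> S x \<Longrightarrow> g e = h e"
      then have "g {z, x} = h {z, x}" if "z \<in> d" for z using that by (auto simp: S_def)
      then have "g {w, x} = h {w, x}" "{z\<in>d - {w}. g {z, x}} = {z\<in>d - {w}. h {z, x}}" using dW by auto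
      then show "Y d x g = Y d x h" by (simp add: Y_def)
    qed
    show "depends_on (\<Union>x\<in>W - d. S x) (H d)"
    proof (rule depends_onI)
      fix g h :: "nat set \<Rightarrow> bool" assume *: "\<And>e. e \<in> (\<Union>x\<in>W - d. S x) \<Longrightarrow> g e = h e"
      have "(\<Sum>x\<in>W - d. Y d x g) = (\<Sum>x\<in>W - d. Y d x h)"
        by (intro sum.cong refl depends_onD[OF depY] *) blast
      then show "H d g = H d h" by (simp add: H_def)
    qed
    show "(\<lambda>z. {u, z}) ` W \<inter> (\<Union>x\<in>W - d. S x) = {}"
      using dW by (auto simp: S_def W_def doubleton_eq_iff)
    have Y0: "0 \<le> Y d x g" "Y d x g \<le> \<theta> ^ 20" for x g using \<theta> by (auto simp: Y_def)
    have EY: "Exp (\<lambda>g. exp (\<kappa> * Y d x g)) \<le> exp (c * \<mu>)" if x: "x \<in> W - d" for x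
    proof -
      have "Exp (\<lambda>g. exp (\<kappa> * Y d x g)) \<le>
        Exp (\<lambda>g. 1 + c * (of_bool (g {w, x}) * (\<Prod>z\<in>d - {w}. 1 - (1 - \<theta>) * of_bool (g {z, x}))))"
      proof (rule expectation_mono[OF finK])
        fix g :: "nat set \<Rightarrow> bool"
        have "exp (\<kappa> * Y d x g) \<le> 1 + exp (\<kappa> * \<theta> ^ 20) * (\<kappa> * Y d x g)"
          using \<kappa> Y0 by (intro exp_le_one_plus_mult mult_left_mono) auto
        also have "\<dots> = 1 + c * Y d x g" by (simp add: c_def)
        also have "Y d x g \<le> of_bool (g {w, x}) * (\<Prod>z\<in>d - {w}. 1 - (1 - \<theta>) * of_bool (g {z, x}))"
          using dW by (subst prod_one_minus_of_bool) (auto simp: Y_def)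
        finally show "exp (\<kappa> * Y d x g) \<le> 1 + c * (of_bool (g {w, x}) * (\<Prod>z\<in>d - {w}. 1 - (1 - \<theta>) * of_bool (g {z, x})))"
          using c0 by (simp add: mult_left_mono)
      qed
      also have "\<dots> = 1 + c * Exp (\<lambda>g. of_bool (g {w, x}) * (\<Prod>z\<in>d - {w}. 1 - (1 - \<theta>) * of_bool (g {z, x})))"
        by (simp add: integrable_Pi_bool finK)
      also have "Exp (\<lambda>g. of_bool (g {w, x}) * (\<Prod>z\<in>d - {w}. 1 - (1 - \<theta>) * of_bool (g {z, x}))) =
        Exp (\<lambda>g. of_bool (g {w, x})) * Exp (\<lambda>g. \<Prod>z\<in>d - {w}. 1 - (1 - \<theta>) * of_bool (g {z, x}))"
      proof (rule expectation_mult_indep[OF finK])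
        show "depends_on {{w, x}} (\<lambda>g. of_bool (g {w, x}) :: real)" by (rule depends_onI) simp
        show "depends_on (\<Union>z\<in>d - {w}. {{z, x}}) (\<lambda>g. \<Prod>z\<in>d - {w}. 1 - (1 - \<theta>) * of_bool (g {z, x}))"
          by (intro depends_on_prod depends_onI) simp
        show "{{w, x}} \<inter> (\<Union>z\<in>d - {w}. {{z, x}}) = {}" using x by (auto simp: doubleton_eq_iff)
      qed
      also have "Exp (\<lambda>g. of_bool (g {w, x})) = p"
        using x dW uw by (simp add: expectation_of_bool finK) (intro Pr_edge, auto simp: W_def)
      also have "Exp (\<lambda>g. \<Prod>z\<in>d - {w}. 1 - (1 - \<theta>) * of_bool (g {z, x})) =
        (\<Prod>z\<in>d - {w}. Exp (\<lambda>g. 1 - (1 - \<theta>) * of_bool (g {z, x})))"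
        by (rule expectation_prod_indep[OF finK, where D = "\<lambda>z. {{z, x}}"])
          (use dW in \<open>auto intro: depends_onI simp: doubleton_eq_iff\<close>)
      also have "\<dots> = (\<Prod>z\<in>d - {w}. 1 - (1 - \<theta>) * p)"
        using x dW by (intro prod.cong refl Exp_factor) (auto simp: W_def)
      also have "\<dots> \<le> (\<Prod>z\<in>d - {w}. exp (- (9/20) * p))"
        using exp_ge_add_one_self[of "- (9/20) * p"] p01 by (intro prod_mono) (auto simp: \<theta>_def)
      also have "\<dots> = exp (- (9/20) * p * (card d - 1))"
        using dW by (simp flip: exp_of_nat_mult)
      also have "\<dots> \<le> exp (- (9/20) * p * (7/10 * n * p - 1))"
      proof -
        have "real (card d - 1) = card d - 1" using dW by (simp add: of_nat_diff Suc_le_eq card_gt_0_iff)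
        then show ?thesis using dW(3) p01 by (simp add: mult_left_mono)
      qed
      finally have "Exp (\<lambda>g. exp (\<kappa> * Y d x g)) \<le> 1 + c * \<mu>"
        using c0 p01 by (simp add: \<mu>_def mult_left_mono)
      also have "\<dots> \<le> exp (c * \<mu>)" by (rule exp_ge_add_one_self)
      finally show ?thesis .
    qed
    have "Pr (H d) \<le> Exp (\<lambda>g. exp (- \<kappa> / 1000) * (\<Prod>x\<in>W - d. exp (\<kappa> * Y d x g)))"
    proof (rule Pr_le_Exp)
      fix g :: "nat set \<Rightarrow> bool"
      have "1 \<le> exp (- \<kappa> / 1000) * (\<Prod>x\<in>W - d. exp (\<kappa> * Y d x g))" if "H d g"
      proof -
        have "\<kappa> * (1/1000) \<le> \<kappa> * (\<Sum>x\<in>W - d. Y d x g)"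
          using that \<kappa> by (intro mult_left_mono) (auto simp: H_def)
        then have "0 \<le> - \<kappa> / 1000 + (\<Sum>x\<in>W - d. \<kappa> * Y d x g)" by (simp add: sum_distrib_left)
        then have "1 \<le> exp (- \<kappa> / 1000 + (\<Sum>x\<in>W - d. \<kappa> * Y d x g))" by simp
        then show ?thesis using finW by (simp only: exp_add exp_sum finite_Diff)
      qed
      then show "of_bool (H d g) \<le> exp (- \<kappa> / 1000) * (\<Prod>x\<in>W - d. exp (\<kappa> * Y d x g))"
        by (auto simp: prod_nonneg)
    qed
    also have "\<dots> = exp (- \<kappa> / 1000) * Exp (\<lambda>g. \<Prod>x\<in>W - d. exp (\<kappa> * Y d x g))" by simp
    also have "Exp (\<lambda>g. \<Prod>x\<in>W - d. exp (\<kappa> * Y d x g)) = (\<Prod>x\<in>W - d. Exp (\<lambda>g. exp (\<kappa> * Y d x g)))"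
      by (rule expectation_prod_indep[OF finK _ depends_on_comp[OF depY] disjS]) (use finW in auto)
    also have "\<dots> \<le> (\<Prod>x\<in>W - d. exp (c * \<mu>))"
      using EY by (intro prod_mono) (auto intro!: integral_nonneg_AE)
    also have "\<dots> = exp (card (W - d) * (c * \<mu>))" by (simp flip: exp_of_nat_mult)
    also have "\<dots> \<le> exp (n * (c * \<mu>))"
    proof -
      have "card (W - d) \<le> card V" by (intro card_mono) (auto simp: W_def)
      then have "real (card (W - d)) * (c * \<mu>) \<le> real n * (c * \<mu>)"
        using c0 \<mu>0 by (intro mult_right_mono) auto
      then show ?thesis by simp
    qed
    finally show "Pr (H d) \<le> exp (- \<kappa> / 1000) * exp (n * (c * \<mu>))" by simp
  qed simp
  have "Pr (\<lambda>g. g {u, w} \<and> 1/1000 < heavy_sum (G g) u w) \<le>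
    Pr (\<lambda>g. card {e\<in>(\<lambda>z. {u, z}) ` W. g e} \<le> 7/10 * n * p \<or> good (\<Phi> g) \<and> H (\<Phi> g) g)"
  proof (rule Pr_mono, rule disjCI)
    fix g assume gw: "g {u, w} \<and> 1/1000 < heavy_sum (G g) u w"
      and ng: "\<not> (good (\<Phi> g) \<and> H (\<Phi> g) g)"
    have "{e\<in>(\<lambda>z. {u, z}) ` W. g e} = (\<lambda>z. {u, z}) ` \<Phi> g" by (auto simp: \<Phi>_def)
    also have "card \<dots> = card (\<Phi> g)" by (intro card_image) (auto simp: inj_on_def doubleton_eq_iff)
    finally have card_eq: "card {e\<in>(\<lambda>z. {u, z}) ` W. g e} = card (\<Phi> g)" .
    have H: "H (\<Phi> g) g"
    proof -
      let ?T = "{x\<in>V. x \<noteq> u \<and> {u, x} \<notin> G g \<and> {w, x} \<in> G g \<and> 20 < card (common_nbrs V (G g) {u, x})}"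
      have TW: "?T \<subseteq> W - \<Phi> g" using uw by (auto simp: W_def \<Phi>_def G_def)
      have "heavy_sum (G g) u w \<le> (\<Sum>x\<in>?T. Y (\<Phi> g) x g)"
        unfolding heavy_sum_def
      proof (rule sum_mono)
        fix x assume x: "x \<in> ?T"
        let ?k = "card (common_nbrs V (G g) {u, x})"
        have "{z \<in> \<Phi> g - {w}. g {z, x}} \<subseteq> common_nbrs V (G g) {u, x}"
          using x uw by (auto simp: \<Phi>_def W_def common_nbrs_def G_def insert_commute)
        then have "card {z \<in> \<Phi> g - {w}. g {z, x}} \<le> ?k"
          by (intro card_mono) (auto simp: common_nbrs_def)
        then have "\<theta> ^ ?k \<le> \<theta> ^ card {z \<in> \<Phi> g - {w}. g {z, x}}" "\<theta> ^ ?k \<le> \<theta> ^ 20"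
          using x \<theta> by (auto intro!: power_decreasing)
        moreover have "g {w, x}" using x by (auto simp: G_def)
        ultimately show "(11/20) ^ ?k \<le> Y (\<Phi> g) x g" by (simp add: Y_def \<theta>_def)
      qed
      also have "\<dots> \<le> (\<Sum>x\<in>W - \<Phi> g. Y (\<Phi> g) x g)"
        using TW finW \<theta> by (intro sum_mono2) (auto simp: Y_def)
      finally show ?thesis using gw by (simp add: H_def)
    qed
    then have "\<not> good (\<Phi> g)" using ng by blast
    then show "card {e\<in>(\<lambda>z. {u, z}) ` W. g e} \<le> 7/10 * n * p"
      unfolding card_eq using gw uw by (auto simp: good_def \<Phi>_def W_def)
  qed
  also have "\<dots> \<le> 2 powr (7/10 * n * p) * exp (- p * card ((\<lambda>z. {u, z}) ` W) / 2) + exp (- \<kappa> / 1000) * exp (n * (c * \<mu>))"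
    by (intro order_trans[OF Pr_disj_le] add_mono 1 Pr_few_present) (use uw in \<open>auto simp: W_def\<close>)
  also have "real (card ((\<lambda>z. {u, z}) ` W)) = real n - 1"
  proof -
    have "card ((\<lambda>z. {u, z}) ` W) = card W" by (intro card_image) (auto simp: inj_on_def doubleton_eq_iff)
    then show ?thesis using uw by (simp add: W_def of_nat_diff)
  qed
  finally show ?thesis by (simp add: c_def \<mu>_def \<theta>_def)
qed

end

section \<open>Asymptotics\<close>

text \<open>Rounding costs at most \<open>2/3\<close> and the removal of \<open>u\<close> and
  \<open>v\<close> at most 2, together less than 3.\<close>

lemma card_residue_class:
  assumes "\<alpha> < 3"
  shows "real n / 3 - 3 \<le> card {a \<in> {..<n} - {u, v}. a mod 3 = \<alpha>}"
proof -
  have "n div 3 = card ((\<lambda>i. 3 * i + \<alpha>) ` {..<n div 3})"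
    by (simp add: card_image inj_on_def)
  also have "\<dots> \<le> card {a \<in> {..<n}. a mod 3 = \<alpha>}"
    using assms by (intro card_mono) auto
  also have "\<dots> \<le> card ({a \<in> {..<n} - {u, v}. a mod 3 = \<alpha>} \<union> {u, v})"
    by (intro card_mono) auto
  also have "\<dots> \<le> card {a \<in> {..<n} - {u, v}. a mod 3 = \<alpha>} + card {u, v}" by (rule card_Un_le)
  also have "card {u, v} \<le> 2" by (simp add: card_insert_if)
  finally have "n div 3 \<le> card {a \<in> {..<n} - {u, v}. a mod 3 = \<alpha>} + 2" by simp
  then have "n \<le> 3 * card {a \<in> {..<n} - {u, v}. a mod 3 = \<alpha>} + 8" by linarith
  then show ?thesis by linarith
qed

definition rc_eq_diam :: "nat \<Rightarrow> nat set set \<Rightarrow> bool" where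
  "rc_eq_diam n E \<longleftrightarrow> rainbow_connection {..<n} E = graph_diam {..<n} E \<and> graph_diam {..<n} E \<in> {2, 3}"

context gnp
begin

text \<open>The deterministic core: once these properties hold, the lower bound on the diameter
  meets the upper bound on the rainbow connection number in either case.\<close>

lemma rc_eq_diamI:
  assumes E: "E \<subseteq> K" "E \<noteq> K"
    and path: "\<And>u v. u \<in> V \<Longrightarrow> v \<in> V \<Longrightarrow> u \<noteq> v \<Longrightarrow> \<exists>a\<in>V - {u, v}. \<exists>b\<in>V - {u, v}. a \<noteq> b \<and>
      {u, a} \<in> E \<and> {a, b} \<in> E \<and> {b, v} \<in> E \<and> distinct [(u + a) mod 3, (a + b) mod 3, (b + v) mod 3]"
    and T: "\<And>u B B'. u \<in> V \<Longrightarrow> small_pair V E B \<Longrightarrow> small_pair V E B' \<Longrightarrow>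
      touches E B u \<Longrightarrow> touches E B' u \<Longrightarrow> B = B'"
    and S: "\<And>u w. {u, w} \<in> E \<Longrightarrow> heavy_sum E u w \<le> 1/1000"
  shows "rc_eq_diam n E"
proof -
  obtain B0 where B0: "B0 \<in> K" "B0 \<notin> E" using E by blast
  have d2: "2 \<le> graph_diam V E" by (rule graph_diam_ge_2[OF B0])
  show ?thesis
  proof (cases "\<forall>B\<in>K. B \<notin> E \<longrightarrow> common_nbrs V E B \<noteq> {}")
    case True
    have "\<exists>g :: nat set \<Rightarrow> bool. \<forall>B\<in>K. B \<notin> E \<longrightarrow> (\<exists>w\<in>common_nbrs V E B. \<exists>b\<in>B. \<exists>b'\<in>B. g {b, w} \<noteq> g {b', w})"
    proof (rule two_colouring_exists[OF _ E(1)])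
      show "common_nbrs V E B \<noteq> {}" if "B \<in> K" "B \<notin> E" for B using True that by blast
    qed (use T S[unfolded heavy_sum_def] in auto)
    then obtain g :: "nat set \<Rightarrow> bool" where
      "\<forall>B\<in>K. B \<notin> E \<longrightarrow> (\<exists>w\<in>common_nbrs V E B. \<exists>b\<in>B. \<exists>b'\<in>B. g {b, w} \<noteq> g {b', w})" by blast
    then have "rainbow_connection V E \<le> 2" by (intro rainbow_connection_le_2[OF E(1), of g]) blast
    then show ?thesis
      using d2 graph_diam_le_rainbow_connection[of V E] by (auto simp: rc_eq_diam_def)
  next
    case False
    then have "3 \<le> graph_diam V E" using graph_diam_ge_3 by blast
    moreover have "rainbow_connection V E \<le> 3" by (rule rainbow_connection_le_3[OF path])
    ultimately show ?thesis
      using graph_diam_le_rainbow_connection[of V E] by (auto simp: rc_eq_diam_def)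
  qed
qed

text \<open>Union bound over the failures of the hypotheses of \<open>rc_eq_diamI\<close>. The
  summand \<open>p\<close> bounds the probability of a complete graph by that of a single edge;
  \<open>\<kappa>\<close> stays free until the size of \<open>p\<close> is known.\<close>

lemma Pr_not_rc_eq_diam:
  fixes \<kappa> :: real
  assumes n: "2 \<le> n" and \<kappa>: "0 \<le> \<kappa>" and p24: "24 * p \<le> 1"
  shows "Pr (\<lambda>g. \<not> rc_eq_diam n (G g)) \<le> p +
    n\<^sup>2 * (2 ^ 24 * exp (- p * (real n / 3 - 3) / 2) + exp (- (12 * p\<^sup>2 * (real n / 3 - 3)))) +
    (n ^ 3 + n ^ 4 * p\<^sup>2 + n ^ 5 * p ^ 4) * Q +
    n\<^sup>2 * (2 powr (7/10 * n * p) * exp (- p * (real n - 1) / 2) +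
      exp (- \<kappa> / 1000) * exp (n * (\<kappa> * exp (\<kappa> * (11/20) ^ 20) * (p * exp (- (9/20) * p * (7/10 * n * p - 1))))))"
proof -
  define NP where "NP = (\<lambda>(u, v) g. u \<noteq> v \<and> \<not> (\<exists>a\<in>V - {u, v}. \<exists>b\<in>V - {u, v}. a \<noteq> b \<and>
      {u, a} \<in> G g \<and> {a, b} \<in> G g \<and> {b, v} \<in> G g \<and> distinct [(u + a) mod 3, (a + b) mod 3, (b + v) mod 3]))"
  define HS where "HS = (\<lambda>(u, w) g. u \<noteq> w \<and> g {u, w} \<and> 1/1000 < heavy_sum (G g) u w)"
  define TT where "TT g \<longleftrightarrow> (\<exists>u\<in>V. \<exists>B B'. small_pair V (G g) B \<and> small_pair V (G g) B' \<and>
      touches (G g) B u \<and> touches (G g) B' u \<and> B \<noteq> B')" for g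
  define bP where "bP = 2 ^ 24 * exp (- p * (real n / 3 - 3) / 2) + exp (- (12 * p\<^sup>2 * (real n / 3 - 3)))"
  define bS where "bS = 2 powr (7/10 * n * p) * exp (- p * (real n - 1) / 2) +
      exp (- \<kappa> / 1000) * exp (n * (\<kappa> * exp (\<kappa> * (11/20) ^ 20) * (p * exp (- (9/20) * p * (7/10 * n * p - 1)))))"
  have "bP \<ge> 0" "bS \<ge> 0" by (auto simp: bP_def bS_def)
  have 1: "Pr (\<lambda>g. G g = K) \<le> p"
  proof -
    have "{0, 1} \<in> K" using n by auto
    then have "Pr (\<lambda>g. G g = K) \<le> Pr (\<lambda>g. g {0, 1})" by (intro Pr_mono) (unfold G_def, blast)
    also have "\<dots> = p" by (rule Pr_edge) fact
    finally show ?thesis .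
  qed
  have 2: "Pr (\<lambda>g. \<exists>i\<in>V \<times> V. NP i g) \<le> card (V \<times> V) * bP"
  proof (rule Pr_bex_le)
    fix i assume "i \<in> V \<times> V"
    then obtain u v where i: "i = (u, v)" and uv: "u \<in> V" "v \<in> V" by blast
    have "Pr (NP (u, v)) \<le> bP"
    proof (cases "u = v")
      case True
      then show ?thesis using \<open>bP \<ge> 0\<close> by (simp add: NP_def)
    next
      case False
      obtain \<alpha> \<beta> :: nat where ab: "\<alpha> < 3" "\<beta> < 3" "\<alpha> \<noteq> \<beta>"
        "\<And>a b. a mod 3 = \<alpha> \<Longrightarrow> b mod 3 = \<beta> \<Longrightarrow> distinct [(u + a) mod 3, (a + b) mod 3, (b + v) mod 3]"
        using residues_for_rainbow[of u v] by metis
      define A B where "A = {a \<in> V - {u, v}. a mod 3 = \<alpha>}" and "B = {b \<in> V - {u, v}. b mod 3 = \<beta>}"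
      have cA: "real n / 3 - 3 \<le> card A" "real n / 3 - 3 \<le> card B"
        unfolding A_def B_def by (intro card_residue_class ab)+
      have "Pr (NP (u, v)) \<le> Pr (\<lambda>g. \<not> (\<exists>a\<in>A. \<exists>b\<in>B. g {u, a} \<and> g {a, b} \<and> g {b, v}))"
      proof (rule Pr_mono, rule notI, elim bexE conjE)
        fix g a b assume np: "NP (u, v) g" and a: "a \<in> A" and b: "b \<in> B" and e: "g {u, a}" "g {a, b}" "g {b, v}"
        have "a \<noteq> b" using a b ab(3) by (auto simp: A_def B_def)
        moreover have "distinct [(u + a) mod 3, (a + b) mod 3, (b + v) mod 3]"
          using a b by (intro ab(4)) (auto simp: A_def B_def)
        moreover have "a \<in> V - {u, v}" "b \<in> V - {u, v}" using a b by (auto simp: A_def B_def)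
        moreover have "{u, a} \<in> G g" "{a, b} \<in> G g" "{b, v} \<in> G g"
          using calculation uv e by (auto simp: G_def)
        ultimately show False using np unfolding NP_def by blast
      qed
      also have "\<dots> \<le> 2 ^ 24 * exp (- p * card B / 2) + (1 - p * (1 - (1 - p) ^ 24)) ^ card A"
        by (rule Pr_no_three_path[OF uv False]) (use ab(3) in \<open>auto simp: A_def B_def\<close>)
      also have "\<dots> \<le> bP"
        unfolding bP_def
      proof (intro add_mono mult_left_mono)
        show "exp (- p * card B / 2) \<le> exp (- p * (real n / 3 - 3) / 2)"
          using mult_left_mono[OF cA(2) p01(1)] by simp
        \<comment> \<open>Bernoulli's inequality turned into an upper bound for
          \<open>(1 - p)^24\<close>: this power times \<open>1 + 24 p\<close> is at most
          \<open>(1 - p^2)^24\<close>.\<close>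
        have "(1 - p) ^ 24 * (1 + real 24 * p) \<le> (1 - p) ^ 24 * (1 + p) ^ 24"
          using p01 Bernoulli_inequality[of p 24] by (intro mult_left_mono) auto
        also have "\<dots> = (1 - p * p) ^ 24" by (simp add: algebra_simps flip: power_mult_distrib)
        also have "\<dots> \<le> 1" using p01 by (intro power_le_one) (auto simp: mult_le_one)
        finally have "(1 - p) ^ 24 + 24 * p * (1 - p) ^ 24 \<le> 1" by (simp add: algebra_simps)
        moreover have "24 * p * (1/2) \<le> 24 * p * (1 - p) ^ 24 \<or> (1 - p) ^ 24 \<le> 1/2"
        proof (cases "(1 - p) ^ 24 \<le> 1/2")
          case False
          then have "1/2 \<le> (1 - p) ^ 24" by simp
          then show ?thesis using p01 by (intro disjI1 mult_left_mono) auto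
        qed simp
        ultimately have "12 * p \<le> 1 - (1 - p) ^ 24" using p24 by auto
        then have q: "12 * p\<^sup>2 \<le> p * (1 - (1 - p) ^ 24)"
          using mult_left_mono[OF _ p01(1), of "12 * p" "1 - (1 - p) ^ 24"] by (simp add: power2_eq_square)
        have "p * (1 - (1 - p) ^ 24) \<le> 1 * 1" using p01 by (intro mult_mono) (auto simp: power_le_one)
        then have "(1 - p * (1 - (1 - p) ^ 24)) ^ card A \<le> exp (- (12 * p\<^sup>2)) ^ card A"
          using q exp_ge_add_one_self[of "- (12 * p\<^sup>2)"] by (intro power_mono) linarith+
        also have "\<dots> = exp (- (12 * p\<^sup>2 * card A))"
          by (simp add: mult.commute flip: exp_of_nat_mult)
        also have "\<dots> \<le> exp (- (12 * p\<^sup>2 * (real n / 3 - 3)))"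
          using cA(1) by (simp add: mult_left_mono)
        finally show "(1 - p * (1 - (1 - p) ^ 24)) ^ card A \<le> exp (- (12 * p\<^sup>2 * (real n / 3 - 3)))" .
      qed simp
      finally show ?thesis .
    qed
    then show "Pr (NP i) \<le> bP" by (simp only: i)
  qed simp
  have 3: "Pr TT \<le> (n ^ 3 + n ^ 4 * p\<^sup>2 + n ^ 5 * p ^ 4) * Q"
    unfolding TT_def by (rule Pr_touch)
  have 4: "Pr (\<lambda>g. \<exists>i\<in>V \<times> V. HS i g) \<le> card (V \<times> V) * bS"
  proof (rule Pr_bex_le)
    fix i assume "i \<in> V \<times> V"
    then obtain u v where i: "i = (u, v)" and uv: "u \<in> V" "v \<in> V" by blast
    have "Pr (HS (u, v)) \<le> bS"
    proof (cases "u = v")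
      case True
      then show ?thesis using \<open>bS \<ge> 0\<close> by (simp add: HS_def)
    next
      case False
      then show ?thesis
        using Pr_heavy_sum[OF uv False \<kappa>] by (simp add: HS_def bS_def)
    qed
    then show "Pr (HS i) \<le> bS" by (simp only: i)
  qed simp
  have "Pr (\<lambda>g. \<not> rc_eq_diam n (G g)) \<le>
    Pr (\<lambda>g. (G g = K \<or> (\<exists>i\<in>V \<times> V. NP i g)) \<or> (TT g \<or> (\<exists>i\<in>V \<times> V. HS i g)))"
  proof (rule Pr_mono, rule ccontr)
    fix g assume bad: "\<not> rc_eq_diam n (G g)"
      and no: "\<not> ((G g = K \<or> (\<exists>i\<in>V \<times> V. NP i g)) \<or> (TT g \<or> (\<exists>i\<in>V \<times> V. HS i g)))"
    have GK: "G g \<subseteq> K" by (auto simp: G_def)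
    have "rc_eq_diam n (G g)"
    proof (rule rc_eq_diamI)
      show "G g \<subseteq> K" "G g \<noteq> K" using GK no by auto
      show "\<exists>a\<in>V - {u, v}. \<exists>b\<in>V - {u, v}. a \<noteq> b \<and> {u, a} \<in> G g \<and> {a, b} \<in> G g \<and> {b, v} \<in> G g \<and>
          distinct [(u + a) mod 3, (a + b) mod 3, (b + v) mod 3]" if "u \<in> V" "v \<in> V" "u \<noteq> v" for u v
      proof -
        have "\<not> NP (u, v) g" using no that by blast
        then show ?thesis using that(3) unfolding NP_def by blast
      qed
      show "B = B'" if "u \<in> V" "small_pair V (G g) B" "small_pair V (G g) B'"
        "touches (G g) B u" "touches (G g) B' u" for u B B'
        using no that unfolding TT_def by blast
      show "heavy_sum (G g) u w \<le> 1/1000" if uw: "{u, w} \<in> G g" for u w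
      proof -
        have "u \<in> V" "w \<in> V" "u \<noteq> w" "g {u, w}" using uw by (auto simp: G_def)
        moreover from this have "\<not> HS (u, w) g" using no by blast
        ultimately show ?thesis by (simp add: HS_def)
      qed
    qed
    then show False using bad by blast
  qed
  also have "\<dots> \<le> (Pr (\<lambda>g. G g = K) + Pr (\<lambda>g. \<exists>i\<in>V \<times> V. NP i g)) + (Pr TT + Pr (\<lambda>g. \<exists>i\<in>V \<times> V. HS i g))"
    by (intro order_trans[OF Pr_disj_le] add_mono Pr_disj_le)
  also have "\<dots> \<le> (p + card (V \<times> V) * bP) + ((n ^ 3 + n ^ 4 * p\<^sup>2 + n ^ 5 * p ^ 4) * Q + card (V \<times> V) * bS)"
    by (intro add_mono 1 2 3 4)
  also have "card (V \<times> V) = n\<^sup>2" by (simp add: card_cartesian_product power2_eq_square)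
  finally show ?thesis by (simp add: bP_def bS_def)
qed

text \<open>Since \<open>p\<close> involves the unknown \<open>\<omega>\<close>, it is replaced by
  \<open>P\<close> or by \<open>sqrt (L / n)\<close>, whichever is the safe side, until the bound is
  an explicit function of \<open>n\<close>.\<close>

lemma Pr_not_rc_eq_diam_le:
  fixes L P :: real
  defines "L \<equiv> ln (real n)" and "P \<equiv> sqrt (3 * L / n)"
  assumes n: "9 \<le> n" and lo: "199/100 * L \<le> n * p\<^sup>2" and up: "n * p\<^sup>2 \<le> 3 * L"
    and P: "24 * P \<le> 1" "L * P \<le> 1" and small: "3000 * n * L * P * exp (1 - 6/10 * L) \<le> 1"
  shows "Pr (\<lambda>g. \<not> rc_eq_diam n (G g)) \<le> P +
    n\<^sup>2 * (2 ^ 24 * exp (- sqrt (L / n) * (real n / 3 - 3) / 2) + exp (36 - 7 * L)) +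
    n ^ 3 * (1 + 3 * L + 9 * L\<^sup>2) * (20 ^ 40 * exp (13 - 378/100 * L)) +
    n\<^sup>2 * (exp (1 - sqrt (n * L) / 100) + exp (1 - 3 * L))"
proof -
  have L0: "0 < L" using n by (simp add: L_def)
  have n0: "0 < real n" using n by simp
  have pP: "p \<le> P"
    unfolding P_def using up n0 by (intro real_le_rsqrt) (simp add: field_simps)
  have lo1: "L \<le> n * p\<^sup>2" using lo L0 by linarith
  have pl: "sqrt (L / n) \<le> p"
    using lo1 n0 p01 by (intro real_le_lsqrt) (auto simp: field_simps)
  have npl: "sqrt (n * L) \<le> n * p"
    using mult_left_mono[OF lo1, of n] n0 p01 L0
    by (intro real_le_lsqrt) (auto simp: power2_eq_square algebra_simps)
  have p2: "p\<^sup>2 \<le> 1" using p01 by (simp add: power_le_one)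
  \<comment> \<open>The choice \<open>\<kappa> = 3000 L\<close> turns
    \<open>exp (- \<kappa> / 1000)\<close> into \<open>n^(-3)\<close>, enough against
    \<open>n^2\<close> pairs, while the cap still holds \<open>\<kappa> \<theta>^20\<close> below
    \<open>2/100 * L\<close>.\<close>
  have "Pr (\<lambda>g. \<not> rc_eq_diam n (G g)) \<le> p +
    n\<^sup>2 * (2 ^ 24 * exp (- p * (real n / 3 - 3) / 2) + exp (- (12 * p\<^sup>2 * (real n / 3 - 3)))) +
    (n ^ 3 + n ^ 4 * p\<^sup>2 + n ^ 5 * p ^ 4) * Q +
    n\<^sup>2 * (2 powr (7/10 * n * p) * exp (- p * (real n - 1) / 2) +
      exp (- (3000 * L) / 1000) * exp (n * (3000 * L * exp (3000 * L * (11/20) ^ 20) *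
        (p * exp (- (9/20) * p * (7/10 * n * p - 1))))))"
    using n pP P L0 by (intro Pr_not_rc_eq_diam) auto
  also have "\<dots> \<le> P +
    n\<^sup>2 * (2 ^ 24 * exp (- sqrt (L / n) * (real n / 3 - 3) / 2) + exp (36 - 7 * L)) +
    n ^ 3 * (1 + 3 * L + 9 * L\<^sup>2) * (20 ^ 40 * exp (13 - 378/100 * L)) +
    n\<^sup>2 * (exp (1 - sqrt (n * L) / 100) + exp (1 - 3 * L))"
  proof (intro add_mono mult_left_mono pP)
    show "exp (- p * (real n / 3 - 3) / 2) \<le> exp (- sqrt (L / n) * (real n / 3 - 3) / 2)"
      using mult_right_mono[OF pl, of "real n / 3 - 3"] n by simp
    show "exp (- (12 * p\<^sup>2 * (real n / 3 - 3))) \<le> exp (36 - 7 * L)"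
      using lo L0 p2 by (simp add: algebra_simps)
    show "(n ^ 3 + n ^ 4 * p\<^sup>2 + n ^ 5 * p ^ 4) * Q \<le>
      n ^ 3 * (1 + 3 * L + 9 * L\<^sup>2) * (20 ^ 40 * exp (13 - 378/100 * L))"
    proof (rule mult_mono)
      have "(n * p\<^sup>2)\<^sup>2 \<le> (3 * L)\<^sup>2" using up by (intro power_mono) auto
      then have "1 + n * p\<^sup>2 + (n * p\<^sup>2)\<^sup>2 \<le> 1 + 3 * L + 9 * L\<^sup>2" using up by (simp add: power_mult_distrib)
      then have "n ^ 3 * (1 + n * p\<^sup>2 + (n * p\<^sup>2)\<^sup>2) \<le> n ^ 3 * (1 + 3 * L + 9 * L\<^sup>2)"
        by (intro mult_left_mono) auto
      then show "n ^ 3 + n ^ 4 * p\<^sup>2 + n ^ 5 * p ^ 4 \<le> n ^ 3 * (1 + 3 * L + 9 * L\<^sup>2)"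
        by (simp add: algebra_simps power_mult_distrib eval_nat_numeral)
      have "n * p\<^sup>2 * p \<le> 3 * L * P" by (rule mult_mono) (use up pP p01 L0 in auto)
      then have "n * p ^ 3 \<le> 3" using P(2) by (simp add: power3_eq_cube power2_eq_square)
      moreover have "0 \<le> p ^ 3" using p01 by simp
      moreover have "(real n - 5) * (19/10 * p\<^sup>2 - p ^ 3) = 19/10 * (n * p\<^sup>2) - n * p ^ 3 - 95/10 * p\<^sup>2 + 5 * p ^ 3"
        by (simp add: algebra_simps diff_divide_distrib)
      \<comment> \<open>\<open>19/10 * 199/100\<close> is \<open>3.781\<close>; an exponent above 3
        is what beats the factor \<open>n^3\<close>.\<close>
      ultimately have "378/100 * L - 13 \<le> (real n - 5) * (19/10 * p\<^sup>2 - p ^ 3)"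
        using lo L0 p2 by linarith
      then show "Q \<le> 20 ^ 40 * exp (13 - 378/100 * L)"
        unfolding Q_def mult_minus_left by simp
    qed (use L0 Q_nonneg in auto)
    show "2 powr (7/10 * n * p) * exp (- p * (real n - 1) / 2) \<le> exp (1 - sqrt (n * L) / 100)"
    proof -
      have "2 powr (7/10 * n * p) * exp (- p * (real n - 1) / 2) = exp (7/10 * n * p * ln 2 + (- p * (real n - 1) / 2))"
        by (simp add: powr_def flip: exp_add)
      also have "\<dots> \<le> exp (1 - sqrt (n * L) / 100)"
      proof -
        \<comment> \<open>\<open>7/10 * 25/36\<close> stays below \<open>1/2\<close> by more than
          \<open>1/100\<close>.\<close>
        have "7/10 * (n * p) * ln 2 \<le> 7/10 * (n * p) * (25/36)"
          using ln2_le_25_over_36 p01 by (intro mult_left_mono) auto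
        moreover have "- p * (real n - 1) / 2 = p / 2 - n * p / 2" by (simp add: algebra_simps diff_divide_distrib)
        moreover have "0 \<le> n * p" using p01 by simp
        ultimately have "7/10 * n * p * ln 2 + (- p * (real n - 1) / 2) \<le> 1 - sqrt (n * L) / 100"
          using npl p01 unfolding mult.assoc by linarith
        then show ?thesis by simp
      qed
      finally show ?thesis .
    qed
    show "exp (- (3000 * L) / 1000) * exp (n * (3000 * L * exp (3000 * L * (11/20) ^ 20) *
        (p * exp (- (9/20) * p * (7/10 * n * p - 1))))) \<le> exp (1 - 3 * L)"
    proof -
      have e1: "3000 * L * (11/20) ^ 20 \<le> 2/100 * L"
        using L0 by (simp add: power_divide)
      have e2: "- (9/20) * p * (7/10 * n * p - 1) \<le> 1 - 62/100 * L"
        using lo p01 L0 by (simp add: algebra_simps power2_eq_square)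
      have "n * (3000 * L * exp (3000 * L * (11/20) ^ 20) * (p * exp (- (9/20) * p * (7/10 * n * p - 1))))
        \<le> n * (3000 * L * exp (2/100 * L) * (P * exp (1 - 62/100 * L)))"
        using L0 p01 pP e1 e2 by (intro mult_left_mono mult_mono) auto
      also have "\<dots> = 3000 * n * L * P * exp (2/100 * L + (1 - 62/100 * L))"
        by (simp only: exp_add) (simp add: algebra_simps)
      \<comment> \<open>The exponent \<open>6/10\<close> exceeds \<open>1/2\<close> and so beats
        \<open>n * P\<close>, which is of order \<open>sqrt (n * L)\<close>.\<close>
      also have "2/100 * L + (1 - 62/100 * L) = 1 - 6/10 * L" by simp
      also have "3000 * n * L * P * exp (1 - 6/10 * L) \<le> 1" by (rule small)
      finally show ?thesis by (simp flip: exp_add)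
    qed
  qed auto
  finally show ?thesis .
qed

end

theorem theorem1:
  fixes \<omega> p :: "nat \<Rightarrow> real"
  assumes "\<omega> \<in> o(\<lambda>n. ln (real n))"
    and "\<And>n. p n = sqrt ((2 * ln (real n) + \<omega> n) / real n)"
  shows "(\<lambda>n. measure_pmf.prob (random_graph n (p n))
            {E. rainbow_connection {..<n} E = graph_diam {..<n} E \<and>
                graph_diam {..<n} E \<in> {2, 3}}) \<longlonglongrightarrow> 1"
proof -
  define R where "R n = sqrt (3 * ln (real n) / n) +
    n\<^sup>2 * (2 ^ 24 * exp (- sqrt (ln (real n) / n) * (real n / 3 - 3) / 2) + exp (36 - 7 * ln (real n))) +
    n ^ 3 * (1 + 3 * ln (real n) + 9 * (ln (real n))\<^sup>2) * (20 ^ 40 * exp (13 - 378/100 * ln (real n))) +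
    n\<^sup>2 * (exp (1 - sqrt (n * ln (real n)) / 100) + exp (1 - 3 * ln (real n)))" for n :: nat
  have R0: "R \<longlonglongrightarrow> 0"
    unfolding R_def by real_asymp
  have ev: "\<forall>\<^sub>F n in sequentially. 9 \<le> n"
    "\<forall>\<^sub>F n in sequentially. 24 * sqrt (3 * ln (real n) / n) \<le> 1"
    "\<forall>\<^sub>F n in sequentially. ln (real n) * sqrt (3 * ln (real n) / n) \<le> 1"
    "\<forall>\<^sub>F n in sequentially. 3000 * n * ln (real n) * sqrt (3 * ln (real n) / n) * exp (1 - 6/10 * ln (real n)) \<le> 1"
    by (real_asymp, real_asymp, real_asymp, real_asymp)
  \<comment> \<open>One percent of \<open>ln n\<close> is the slack built into the constants; it
    yields the lower bound \<open>199/100 * L\<close> for \<open>n p^2\<close>.\<close>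
  have om: "\<forall>\<^sub>F n in sequentially. norm (\<omega> n) \<le> 1/100 * norm (ln (real n))"
    using landau_o.smallD[OF assms(1), of "1/100"] by simp
  have lower: "\<forall>\<^sub>F n in sequentially. 1 - R n \<le> measure_pmf.prob (random_graph n (p n)) {E. rc_eq_diam n E}"
    using ev om
  proof eventually_elim
    case (elim n)
    define L where "L = ln (real n)"
    have L0: "0 < L" using elim(1) by (simp add: L_def)
    have om: "\<bar>\<omega> n\<bar> \<le> 1/100 * L" using elim(5) L0 by (simp add: L_def)
    have np2: "n * (p n)\<^sup>2 = 2 * L + \<omega> n"
      using elim(1) om L0 by (simp add: assms(2) L_def)
    have p0: "0 \<le> p n" using om L0 by (auto simp: assms(2) L_def intro!: divide_nonneg_nonneg)
    have "p n \<le> sqrt (3 * L / n)"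
      unfolding assms(2) using om L0 elim(1) by (simp add: L_def divide_right_mono)
    then have "p n \<le> 1" using elim(2) by (simp add: L_def)
    then interpret gnp n "p n" using p0 by unfold_locales
    have "Pr (\<lambda>g. \<not> rc_eq_diam n (G g)) \<le> R n"
      unfolding R_def
      by (rule Pr_not_rc_eq_diam_le) (use elim om np2 L0 in \<open>auto simp: L_def\<close>)
    then have "1 - R n \<le> Pr (\<lambda>g. rc_eq_diam n (G g))" by (simp only: Pr_not)
    also have "\<dots> = measure_pmf.prob (random_graph n (p n)) {E. rc_eq_diam n E}"
      by (simp add: random_graph_def G_def vimage_def)
    finally show ?case .
  qed
  have "(\<lambda>n. measure_pmf.prob (random_graph n (p n)) {E. rc_eq_diam n E}) \<longlonglongrightarrow> 1"
  proof (rule tendsto_sandwich[OF lower])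
    show "(\<lambda>n. 1 - R n) \<longlonglongrightarrow> 1" using tendsto_diff[OF tendsto_const R0, of 1] by simp
    show "\<forall>\<^sub>F n in sequentially. measure_pmf.prob (random_graph n (p n)) {E. rc_eq_diam n E} \<le> 1"
      by (intro always_eventually allI measure_pmf.prob_le_1)
  qed (rule tendsto_const)
  then show ?thesis by (simp only: rc_eq_diam_def)
qed

end
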